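(* An infinite countable group $G$ is amenable if and only if there exists a multiorder on $G$.
   Context: A group $G$ is amenable if it has a Følner sequence, i.e. a sequence of finite subsets $F_n\subset G$ with $\lim_n |F_n\cap gF_n|/|F_n|=1$ for every $g\in G$. A linear order $\prec$ on $G$ is of type $\mathbb Z$ if every order interval $[a,b]^{\prec}=\{a,b\}\cup\{g\in G: a\prec g\prec b\}$ ($a\prec b$) is finite and $G$ has no minimal or maximal element. The set $\tilde{\mathcal O}$ of all orders of type $\mathbb Z$ on $G$ is a Borel subset of $\{0,1\}^{G\times G}$ (relations identified with their indicator functions, product topology), with the inherited Borel sigma-algebra. $G$ acts on $\tilde{\mathcal O}$ by: $\prec'=g(\prec)$ where $a\prec' b\iff ag\prec bg$. A multiorder on $G$ is the measure-preserving action $(\tilde{\mathcal O},\nu,G)$, where $\nu$ is a $G$-invariant Borel probability measure on $\tilde{\mathcal O}$. *)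

theory Defs
  imports "HOL-Algebra.Coset" "HOL-Probability.Probability"
begin

definition Folner_sequence :: "('a, 'b) monoid_scheme \<Rightarrow> (nat \<Rightarrow> 'a set) \<Rightarrow> bool" where
  "Folner_sequence G F \<longleftrightarrow>
     (\<forall>n. finite (F n) \<and> F n \<noteq> {} \<and> F n \<subseteq> carrier G) \<and>
     (\<forall>g\<in>carrier G.
        (\<lambda>n. real (card (F n \<inter> (g <#\<^bsub>G\<^esub> F n))) / real (card (F n))) \<longlonglongrightarrow> 1)"

definition amenable :: "('a, 'b) monoid_scheme \<Rightarrow> bool" where
  "amenable G \<longleftrightarrow> (\<exists>F. Folner_sequence G F)"

definition order_interval :: "'a set \<Rightarrow> 'a rel \<Rightarrow> 'a \<Rightarrow> 'a \<Rightarrow> 'a set" where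
  "order_interval X r a b = {a, b} \<union> {g \<in> X. (a, g) \<in> r \<and> (g, b) \<in> r}"

text \<open>Orders are strict relations contained in \<open>carrier G \<times> carrier G\<close>.\<close>

definition Z_orders :: "('a, 'b) monoid_scheme \<Rightarrow> 'a rel set" where
  "Z_orders G = {r. r \<subseteq> carrier G \<times> carrier G \<and>
     strict_linear_order_on (carrier G) r \<and>
     (\<forall>a b. (a, b) \<in> r \<longrightarrow> finite (order_interval (carrier G) r a b)) \<and>
     (\<forall>g\<in>carrier G. \<exists>a\<in>carrier G. (a, g) \<in> r) \<and>
     (\<forall>g\<in>carrier G. \<exists>b\<in>carrier G. (g, b) \<in> r)}"

definition relation_indicator :: "('a, 'b) monoid_scheme \<Rightarrow> 'a rel \<Rightarrow> 'a \<times> 'a \<Rightarrow> nat" where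
  "relation_indicator G r = restrict (indicator r) (carrier G \<times> carrier G)"

definition borel_of_topology :: "'x topology \<Rightarrow> 'x measure" where
  "borel_of_topology X = sigma (topspace X) {U. openin X U}"

definition relation_topology :: "('a, 'b) monoid_scheme \<Rightarrow> ('a \<times> 'a \<Rightarrow> nat) topology" where
  "relation_topology G =
     product_topology (\<lambda>_. discrete_topology {0, 1}) (carrier G \<times> carrier G)"

text \<open>The Borel structure inherited from \<open>{0, 1}\<close> to the power \<open>G \<times> G\<close>; as an element
  of type \<^typ>\<open>'a rel measure\<close> only its space and its measurable sets matter.\<close>

definition Z_order_space :: "('a, 'b) monoid_scheme \<Rightarrow> 'a rel measure" where
  "Z_order_space G =
     vimage_algebra (Z_orders G) (relation_indicator G) (borel_of_topology (relation_topology G))"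

definition order_action :: "('a, 'b) monoid_scheme \<Rightarrow> 'a \<Rightarrow> 'a rel \<Rightarrow> 'a rel" where
  "order_action G g r =
     {(a, b) \<in> carrier G \<times> carrier G. (a \<otimes>\<^bsub>G\<^esub> g, b \<otimes>\<^bsub>G\<^esub> g) \<in> r}"

text \<open>The space and the action are determined by \<open>G\<close>, so a multiorder is given by its measure.
  Measurability is required explicitly because \<^const>\<open>distr\<close> is only the image measure
  for measurable maps.\<close>

definition multiorder :: "('a, 'b) monoid_scheme \<Rightarrow> 'a rel measure \<Rightarrow> bool" where
  "multiorder G \<nu> \<longleftrightarrow>
     prob_space \<nu> \<and> sets \<nu> = sets (Z_order_space G) \<and>
     (\<forall>g\<in>carrier G. order_action G g \<in> measurable \<nu> \<nu> \<and> distr \<nu> \<nu> (order_action G g) = \<nu>)"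

end

theory Submission imports Defs begin

text \<open>If \<open>\<nu>\<close> is a multiorder, then the interval consisting of the first \<open>n\<close> elements from \<open>\<one>\<close> on
  is almost invariant for some order: by mass transport the expected number of its elements \<open>x\<close>
  with \<open>x\<close> and \<open>g x\<close> more than \<open>L\<close> apart is at most \<open>n\<close> times the probability that \<open>\<one>\<close>
  and \<open>g\<close> are more than \<open>L\<close> apart, and if \<open>x\<close> and \<open>g x\<close> are closer than that, then \<open>g x\<close> lies
  outside the interval only for \<open>x\<close> near one of its two ends.

  Conversely, let \<open>T\<^sub>0 = {\<one>}, T\<^sub>1, T\<^sub>2, \<dots>\<close> be a quickly improving sequence of Folner sets, and give the
  pairs \<open>(k, c)\<close> independent uniform labels. At level \<open>k\<close> send \<open>x\<close> to the point of \<open>T\<^sub>k\<^sup>-\<^sup>1 x\<close>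
  of least label. Two points are sent to different places with probability at most the relative size
  of the symmetric difference of their neighbourhoods, so by Borel--Cantelli they agree at all high
  levels, while each fibre is contained in a translate of \<open>T\<^sub>k\<close>. Comparing labels at the highest
  level of disagreement gives an invariant random order with finite intervals. It has no extremal
  element, because the position of such an element would be an invariant random point of an infinite
  group.\<close>

section \<open>The measurable space of orders\<close>

locale countable_group = group +
  assumes countable_carrier: "countable (carrier G)"
begin

lemma space_Z_order_space [simp]: "space (Z_order_space G) = Z_orders G"
  by (simp add: Z_order_space_def)

lemma sets_borel_of_relation_topology:
  "sets (borel_of_topology (relation_topology G))
     = sigma_sets (topspace (relation_topology G)) {U. openin (relation_topology G) U}"
  unfolding borel_of_topology_def by (rule sets_measure_of) (auto dest: openin_subset)

lemma relation_indicator_in_topspace: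
  "relation_indicator G r \<in> topspace (relation_topology G)"
  by (auto simp: relation_indicator_def relation_topology_def indicator_def)

lemma sets_pair_in_relation:
  assumes "a \<in> carrier G" "b \<in> carrier G"
  shows "{r \<in> Z_orders G. (a, b) \<in> r} \<in> sets (Z_order_space G)"
proof -
  let ?U = "{f \<in> topspace (relation_topology G). f (a, b) \<in> {1}}"
  have "continuous_map (relation_topology G) (discrete_topology {0, 1::nat}) (\<lambda>f. f (a, b))"
    unfolding relation_topology_def
    by (rule continuous_map_product_projection) (use assms in auto)
  then have "openin (relation_topology G) ?U"
    by (rule openin_continuous_map_preimage) auto
  then have "?U \<in> sets (borel_of_topology (relation_topology G))"
    unfolding sets_borel_of_relation_topology by blast
  then have "relation_indicator G -` ?U \<inter> Z_orders G \<in> sets (Z_order_space G)"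
    unfolding Z_order_space_def by (rule in_vimage_algebra)
  also have "relation_indicator G -` ?U \<inter> Z_orders G = {r \<in> Z_orders G. (a, b) \<in> r}"
    using assms relation_indicator_in_topspace
    by (auto simp: relation_indicator_def indicator_def split: if_splits)
  finally show ?thesis .
qed

text \<open>There are countably many pairs, so every open set is a countable union of cylinders
  prescribing finitely many coordinates. Measurability into the Borel structure thus reduces to the
  events that a given pair is related.\<close>

lemma measurable_Z_order_space:
  assumes f: "f \<in> space M \<rightarrow> Z_orders G"
    and pairs: "\<And>a b. a \<in> carrier G \<Longrightarrow> b \<in> carrier G \<Longrightarrow> {w \<in> space M. (a, b) \<in> f w} \<in> sets M"
  shows "f \<in> measurable M (Z_order_space G)"
  unfolding Z_order_space_def
proof (rule measurable_vimage_algebra2)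
  show "(\<lambda>w. relation_indicator G (f w)) \<in> measurable M (borel_of_topology (relation_topology G))"
    unfolding borel_of_topology_def
  proof (rule measurable_measure_of)
    show "{U. openin (relation_topology G) U} \<subseteq> Pow (topspace (relation_topology G))"
      by (auto dest: openin_subset)
    show "(\<lambda>w. relation_indicator G (f w)) \<in> space M \<rightarrow> topspace (relation_topology G)"
      using relation_indicator_in_topspace by blast
    fix U assume "U \<in> {U. openin (relation_topology G) U}"
    then have U: "openin (relation_topology G) U" by simp
    let ?I = "carrier G \<times> carrier G"
    define cyl where "cyl = (\<lambda>(P, N). {w \<in> space M. P \<subseteq> f w \<and> N \<inter> f w = {}})"
    define fins where "fins = {A. finite A \<and> A \<subseteq> ?I}"
    have "countable ?I"
      using countable_carrier by blast
    then have fins: "countable (fins \<times> fins)"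
      unfolding fins_def using countable_Collect_finite_subset by blast
    define S where "S = {p \<in> fins \<times> fins. cyl p \<subseteq> (\<lambda>w. relation_indicator G (f w)) -` U \<inter> space M}"
    have cyl_sets: "cyl p \<in> sets M" if p_fins: "p \<in> fins \<times> fins" for p
    proof -
      obtain P N where p: "p = (P, N)" "P \<subseteq> ?I" "finite P" "N \<subseteq> ?I" "finite N"
        using p_fins by (auto simp: fins_def)
      have *: "{w \<in> space M. i \<in> f w} \<in> sets M" if "i \<in> ?I" for i
        using pairs[of "fst i" "snd i"] that by auto
      have "cyl p = {w \<in> space M. (\<forall>i\<in>P. i \<in> f w) \<and> (\<forall>i\<in>N. \<not> i \<in> f w)}"
        by (auto simp: cyl_def p)
      also have "\<dots> \<in> sets M"
        using p by (intro sets.sets_Collect_conj sets.sets_Collect_finite_All sets.sets_Collect_neg *) auto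
      finally show ?thesis .
    qed
    have "(\<lambda>w. relation_indicator G (f w)) -` U \<inter> space M = (\<Union>p\<in>S. cyl p)"
    proof (intro equalityI subsetI)
      fix w assume w: "w \<in> (\<lambda>w. relation_indicator G (f w)) -` U \<inter> space M"
      then obtain V where V: "finite {i \<in> ?I. V i \<noteq> {0, 1}}"
        "relation_indicator G (f w) \<in> Pi\<^sub>E ?I V" "Pi\<^sub>E ?I V \<subseteq> U"
        using U unfolding relation_topology_def openin_product_topology_alt by auto
      \<comment> \<open>The box \<open>V\<close> restricts only these finitely many coordinates, so
        agreeing with \<open>f w\<close> on \<open>J\<close> is enough to land in
        \<open>U\<close>.\<close>
      define J where "J = {i \<in> ?I. V i \<noteq> {0, 1}}"
      have ind: "relation_indicator G (f w') \<in> U"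
        if J: "J \<inter> f w \<subseteq> f w'" "(J - f w) \<inter> f w' = {}" for w'
      proof (rule subsetD[OF V(3)], rule PiE_I)
        fix i assume i: "i \<in> ?I"
        show "relation_indicator G (f w') i \<in> V i"
        proof (cases "V i = {0, 1}")
          case True then show ?thesis using i by (auto simp: relation_indicator_def indicator_def)
        next
          case False
          then have "i \<in> J" using i by (simp add: J_def)
          then have "i \<in> f w \<longleftrightarrow> i \<in> f w'" using J by blast
          then have "relation_indicator G (f w') i = relation_indicator G (f w) i"
            using i by (auto simp: relation_indicator_def indicator_def)
          then show ?thesis using V(2) i by (auto simp: PiE_def Pi_def)
        qed
      qed (auto simp: relation_indicator_def)
      have "cyl (J \<inter> f w, J - f w) \<subseteq> (\<lambda>w. relation_indicator G (f w)) -` U \<inter> space M"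
        using ind by (auto simp: cyl_def)
      moreover have "finite J" "J \<subseteq> ?I"
        using V(1) by (auto simp: J_def)
      then have "(J \<inter> f w, J - f w) \<in> fins \<times> fins"
        by (auto simp: fins_def)
      ultimately have "(J \<inter> f w, J - f w) \<in> S"
        by (simp add: S_def)
      moreover have "w \<in> cyl (J \<inter> f w, J - f w)"
        using w by (auto simp: cyl_def)
      ultimately show "w \<in> (\<Union>p\<in>S. cyl p)" by blast
    qed (auto simp: S_def)
    also have "\<dots> \<in> sets M"
      by (rule sets.countable_UN'') (auto simp: S_def intro: cyl_sets countable_subset[OF _ fins])
    finally show "(\<lambda>w. relation_indicator G (f w)) -` U \<inter> space M \<in> sets M" .
  qed
qed (use f in auto)

end

section \<open>Segments of orders of type \<open>\<int>\<close>\<close>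

lemma Z_ordersD:
  assumes "r \<in> Z_orders G"
  shows "(a, b) \<in> r \<Longrightarrow> a \<in> carrier G" "(a, b) \<in> r \<Longrightarrow> b \<in> carrier G"
    and "(a, a) \<notin> r"
    and "(a, b) \<in> r \<Longrightarrow> (b, c) \<in> r \<Longrightarrow> (a, c) \<in> r"
    and "a \<in> carrier G \<Longrightarrow> b \<in> carrier G \<Longrightarrow> a \<noteq> b \<Longrightarrow> (a, b) \<in> r \<or> (b, a) \<in> r"
    and "a \<in> carrier G \<Longrightarrow> \<exists>b. (a, b) \<in> r"
    and "a \<in> carrier G \<Longrightarrow> \<exists>b. (b, a) \<in> r"
    and "(a, b) \<in> r \<Longrightarrow> finite (order_interval (carrier G) r a b)"
  using assms
  by (auto simp: Z_orders_def strict_linear_order_on_def irrefl_on_def total_on_def dest: transD)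

text \<open>Omitting the left end and keeping the right one lets consecutive intervals concatenate
  without overlap, which makes \<open>steps\<close> additive. For an order of type Z,
  \<open>steps r a b\<close> is the distance from \<open>a\<close> to \<open>b\<close>, and 0 if
  \<open>b\<close> does not come after \<open>a\<close>.\<close>

definition half_open :: "'a rel \<Rightarrow> 'a \<Rightarrow> 'a \<Rightarrow> 'a set" where
  "half_open r a b = {z. (a, z) \<in> r \<and> (z, b) \<in> r\<^sup>=}"

definition steps :: "'a rel \<Rightarrow> 'a \<Rightarrow> 'a \<Rightarrow> nat" where
  "steps r a b = card (half_open r a b)"

text \<open>The test \<open>(x, e) \<notin> r\<close> excludes the elements before \<open>e\<close>,
  for which \<open>steps r e x\<close> is 0 as well. What remains is the run of \<open>n\<close>
  consecutive elements that starts at \<open>e\<close>.\<close>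

definition segment :: "('a, 'b) monoid_scheme \<Rightarrow> 'a rel \<Rightarrow> 'a \<Rightarrow> nat \<Rightarrow> 'a set" where
  "segment G r e n = {x \<in> carrier G. (x, e) \<notin> r \<and> steps r e x < n}"

context
  fixes G :: "('a, 'b) monoid_scheme" and r
  assumes r: "r \<in> Z_orders G"
begin

private lemmas Z = Z_ordersD[OF r]

lemma finite_half_open: "finite (half_open r a b)"
proof (cases "(a, b) \<in> r")
  case True
  have "half_open r a b \<subseteq> order_interval (carrier G) r a b"
    using Z(1,2) by (auto simp: half_open_def order_interval_def)
  then show ?thesis using Z(8)[OF True] finite_subset by blast
next
  case False
  then have "half_open r a b = {}" using Z(4) by (auto simp: half_open_def)
  then show ?thesis by simp
qed

lemma steps_self: "steps r a a = 0"
proof -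
  have "half_open r a a = {}" using Z(3,4) by (auto simp: half_open_def)
  then show ?thesis by (simp add: steps_def)
qed

lemma steps_pos: "(a, b) \<in> r \<Longrightarrow> 0 < steps r a b"
  unfolding steps_def using finite_half_open by (auto simp: card_gt_0_iff half_open_def)

lemma steps_add:
  assumes "(a, b) \<in> r\<^sup>=" "(b, c) \<in> r\<^sup>="
  shows "steps r a c = steps r a b + steps r b c"
proof (cases "a = b \<or> b = c")
  case True then show ?thesis by (auto simp: steps_self)
next
  case False
  then have ab: "(a, b) \<in> r" "(b, c) \<in> r" using assms by auto
  have "half_open r a c = half_open r a b \<union> half_open r b c"
  proof (intro equalityI subsetI)
    fix z assume z: "z \<in> half_open r a c"
    then have "z \<in> carrier G" using Z by (auto simp: half_open_def)
    then show "z \<in> half_open r a b \<union> half_open r b c"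
      using Z(5)[of z b] z Z(2)[OF ab(1)] by (auto simp: half_open_def)
  qed (use ab Z(4) in \<open>auto simp: half_open_def\<close>)
  moreover have "half_open r a b \<inter> half_open r b c = {}"
    using Z(3,4) by (auto simp: half_open_def)
  ultimately show ?thesis
    unfolding steps_def by (simp add: card_Un_disjoint finite_half_open)
qed

lemma steps_from_inject:
  assumes "x \<in> carrier G" "y \<in> carrier G" "e \<in> carrier G" "(x, e) \<notin> r" "(y, e) \<notin> r"
    and "steps r e x = steps r e y"
  shows "x = y"
proof (rule ccontr)
  assume "x \<noteq> y"
  moreover have "(e, x) \<in> r\<^sup>=" "(e, y) \<in> r\<^sup>=" using assms Z(5) by auto
  ultimately show False
    using Z(5)[of x y] assms steps_add[of e x y] steps_add[of e y x] steps_pos[of x y] steps_pos[of y x]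
    by auto
qed

lemma steps_to_inject:
  assumes "x \<in> carrier G" "y \<in> carrier G" "e \<in> carrier G" "(e, x) \<notin> r" "(e, y) \<notin> r"
    and "steps r x e = steps r y e"
  shows "x = y"
proof (rule ccontr)
  assume "x \<noteq> y"
  moreover have "(x, e) \<in> r\<^sup>=" "(y, e) \<in> r\<^sup>=" using assms Z(5) by auto
  ultimately show False
    using Z(5)[of x y] assms steps_add[of x y e] steps_add[of y x e] steps_pos[of x y] steps_pos[of y x]
    by auto
qed

lemma ex_immediate_successor:
  assumes "x \<in> carrier G"
  shows "\<exists>y. (x, y) \<in> r \<and> steps r x y = 1"
proof -
  obtain b where b: "(x, b) \<in> r" using Z(6) assms by blast
  \<comment> \<open>Some element lies above \<open>x\<close>, so a closest one exists; an element
    strictly between would be closer still by additivity.\<close>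
  define y where "y = arg_min (steps r x) (\<lambda>y. (x, y) \<in> r)"
  have y: "(x, y) \<in> r" and y_min: "\<And>z. (x, z) \<in> r \<Longrightarrow> steps r x y \<le> steps r x z"
    unfolding y_def using arg_min_natI[where P = "\<lambda>y. (x, y) \<in> r", OF b]
      arg_min_nat_le[where P = "\<lambda>y. (x, y) \<in> r" and m = "steps r x"] by auto
  have "half_open r x y = {y}"
  proof (intro equalityI subsetI)
    fix z assume z: "z \<in> half_open r x y"
    show "z \<in> {y}"
    proof (rule ccontr)
      assume "z \<notin> {y}"
      then have "(x, z) \<in> r" "(z, y) \<in> r" using z by (auto simp: half_open_def)
      then show False using y_min[of z] steps_add[of x z y] steps_pos[of z y] by simp
    qed
  qed (use y in \<open>auto simp: half_open_def\<close>)
  then show ?thesis using y by (auto simp: steps_def)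
qed

lemma ex_steps_eq:
  assumes e: "e \<in> carrier G"
  shows "\<exists>x\<in>carrier G. (x, e) \<notin> r \<and> steps r e x = n"
proof (induction n)
  case 0 then show ?case using e Z(3) steps_self by blast
next
  case (Suc n)
  then obtain x where x: "x \<in> carrier G" "(x, e) \<notin> r" "steps r e x = n" by blast
  obtain y where y: "(x, y) \<in> r" "steps r x y = 1" using ex_immediate_successor x(1) by blast
  have "(e, x) \<in> r\<^sup>=" using Z(5) x e by auto
  then have "steps r e y = Suc n" using steps_add[of e x y] x y by simp
  moreover have "(y, e) \<notin> r" using y x Z(4) by blast
  ultimately show ?case using Z(2)[OF y(1)] by blast
qed

text \<open>Distance from \<open>e\<close> is a bijection from the elements at or after
  \<open>e\<close> onto the natural numbers: injective by \<open>steps_from_inject\<close>,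
  surjective by \<open>ex_steps_eq\<close>. Counting in the order becomes counting in
  \<open>nat\<close>.\<close>

lemma card_steps_from:
  assumes e: "e \<in> carrier G"
  shows "card {x \<in> carrier G. (x, e) \<notin> r \<and> steps r e x \<in> S} = card S"
    and "finite {x \<in> carrier G. (x, e) \<notin> r \<and> steps r e x \<in> S} \<longleftrightarrow> finite S"
proof -
  have "bij_betw (steps r e) {x \<in> carrier G. (x, e) \<notin> r \<and> steps r e x \<in> S} S"
    unfolding bij_betw_def
  proof
    show "inj_on (steps r e) {x \<in> carrier G. (x, e) \<notin> r \<and> steps r e x \<in> S}"
      using steps_from_inject e by (auto intro!: inj_onI)
    show "steps r e ` {x \<in> carrier G. (x, e) \<notin> r \<and> steps r e x \<in> S} = S"
      using ex_steps_eq[OF e] by (auto simp: image_iff) metis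
  qed
  then show "card {x \<in> carrier G. (x, e) \<notin> r \<and> steps r e x \<in> S} = card S"
    "finite {x \<in> carrier G. (x, e) \<notin> r \<and> steps r e x \<in> S} \<longleftrightarrow> finite S"
    by (auto simp: bij_betw_same_card bij_betw_finite)
qed

lemma card_segment: "e \<in> carrier G \<Longrightarrow> card (segment G r e n) = n"
  and finite_segment: "e \<in> carrier G \<Longrightarrow> finite (segment G r e n)"
  using card_steps_from[of e "{..<n}"] by (simp_all add: segment_def)

text \<open>If \<open>y\<close> lies before \<open>e\<close>, the way from \<open>y\<close> to
  \<open>x\<close> contains the whole stretch from \<open>e\<close> to \<open>x\<close>, so
  \<open>x\<close> is near the start. If \<open>y\<close> lies past the end, the way from
  \<open>x\<close> to \<open>y\<close> contains what is left of the segment, so \<open>x\<close> is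
  near the end.\<close>

lemma segment_exit:
  assumes "e \<in> carrier G" "x \<in> segment G r e n" "y \<in> carrier G" "y \<notin> segment G r e n"
    and L: "steps r x y \<le> L" "steps r y x \<le> L"
  shows "steps r e x < L \<or> n - L \<le> steps r e x"
proof -
  have x: "x \<in> carrier G" "(e, x) \<in> r\<^sup>=" "steps r e x < n"
    using assms Z(5) by (auto simp: segment_def)
  show ?thesis
  proof (cases "(y, e) \<in> r")
    case True
    then show ?thesis
      using steps_add[of y e x] x L steps_pos[OF True] by simp
  next
    case False
    then have ey: "(e, y) \<in> r\<^sup>=" "n \<le> steps r e y" using assms Z(5) by (auto simp: segment_def)
    have "x \<noteq> y" using x ey by auto
    moreover have "(y, x) \<notin> r" using steps_add[OF ey(1), of x] x ey(2) by auto
    ultimately have "(x, y) \<in> r" using Z(5) x assms by blast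
    then show ?thesis using steps_add[OF x(2), of y] ey L by force
  qed
qed

text \<open>Only the first \<open>L\<close> and the last \<open>L\<close> positions can be left by a
  short jump, and their number does not grow with \<open>n\<close>.\<close>

lemma card_segment_exit:
  assumes "e \<in> carrier G"
  shows "card {x \<in> segment G r e n. h x \<in> carrier G - segment G r e n \<and>
            steps r x (h x) \<le> L \<and> steps r (h x) x \<le> L} \<le> 2 * L" (is "card ?X \<le> _")
proof -
  let ?S = "{..<L} \<union> {n - L..<n}"
  have "?X \<subseteq> {x \<in> carrier G. (x, e) \<notin> r \<and> steps r e x \<in> ?S}"
    using segment_exit[OF assms] by (auto simp: segment_def)
  then have "card ?X \<le> card ?S"
    using card_mono[of "{x \<in> carrier G. (x, e) \<notin> r \<and> steps r e x \<in> ?S}" ?X]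
    unfolding card_steps_from[OF assms] by simp
  also have "\<dots> \<le> card {..<L} + card {n - L..<n}" by (rule card_Un_le)
  also have "\<dots> \<le> 2 * L" by simp
  finally show ?thesis .
qed

end

section \<open>From multiorders to Folner sets\<close>

text \<open>The event is a union over the \<open>m\<close>-element subsets of \<open>A\<close>, and
  a countable set has only countably many finite subsets. Finiteness of the count matters because
  infinite sets have \<open>card\<close> 0.\<close>

lemma sets_le_card_Collect:
  assumes "countable A" and P: "\<And>z. z \<in> A \<Longrightarrow> {w \<in> space M. P z w} \<in> sets M"
    and fin: "\<And>w. w \<in> space M \<Longrightarrow> finite {z \<in> A. P z w}"
  shows "{w \<in> space M. m \<le> card {z \<in> A. P z w}} \<in> sets M"
proof -
  define \<S> where "\<S> = {S. finite S \<and> S \<subseteq> A} \<inter> {S. card S = m}"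
  have "{w \<in> space M. m \<le> card {z \<in> A. P z w}} = (\<Union>S\<in>\<S>. {w \<in> space M. \<forall>z\<in>S. P z w})"
  proof (intro equalityI subsetI)
    fix w assume w: "w \<in> {w \<in> space M. m \<le> card {z \<in> A. P z w}}"
    then obtain S where "S \<subseteq> {z \<in> A. P z w}" "card S = m" "finite S"
      using obtain_subset_with_card_n by blast
    then show "w \<in> (\<Union>S\<in>\<S>. {w \<in> space M. \<forall>z\<in>S. P z w})"
      using w by (auto simp: \<S>_def)
  next
    fix w assume "w \<in> (\<Union>S\<in>\<S>. {w \<in> space M. \<forall>z\<in>S. P z w})"
    then obtain S where S: "S \<subseteq> {z \<in> A. P z w}" "card S = m" and w: "w \<in> space M"
      by (auto simp: \<S>_def)
    then show "w \<in> {w \<in> space M. m \<le> card {z \<in> A. P z w}}"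
      using card_mono[OF fin S(1)] by simp
  qed
  also have "\<dots> \<in> sets M"
  proof (rule sets.countable_UN'')
    show "countable \<S>"
      unfolding \<S>_def using countable_Collect_finite_subset[OF assms(1)]
      by (rule countable_subset[rotated]) auto
    show "{w \<in> space M. \<forall>z\<in>S. P z w} \<in> sets M" if "S \<in> \<S>" for S
      using that by (intro sets.sets_Collect_finite_All P) (auto simp: \<S>_def)
  qed
  finally show ?thesis .
qed

lemma measurable_card_Collect:
  assumes "countable A" and "\<And>z. z \<in> A \<Longrightarrow> {w \<in> space M. P z w} \<in> sets M"
    and "\<And>w. w \<in> space M \<Longrightarrow> finite {z \<in> A. P z w}"
  shows "(\<lambda>w. card {z \<in> A. P z w}) \<in> measurable M (count_space UNIV)"
proof (subst measurable_count_space_eq2_countable, simp_all, intro allI)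
  fix n
  have "(\<lambda>w. card {z \<in> A. P z w}) -` {n} \<inter> space M =
      {w \<in> space M. n \<le> card {z \<in> A. P z w}} - {w \<in> space M. Suc n \<le> card {z \<in> A. P z w}}"
    by auto
  then show "(\<lambda>w. card {z \<in> A. P z w}) -` {n} \<inter> space M \<in> sets M"
    using sets_le_card_Collect[OF assms] by auto
qed

text \<open>Right translation by \<open>g\<close> is an isomorphism from the translated order to
  \<open>r\<close>, hence a bijection between the half-open intervals.\<close>

lemma (in group) steps_order_action:
  assumes r: "r \<subseteq> carrier G \<times> carrier G" and [simp]: "g \<in> carrier G" "a \<in> carrier G" "b \<in> carrier G"
  shows "steps (order_action G g r) a b = steps r (a \<otimes> g) (b \<otimes> g)"
  unfolding steps_def
proof (rule bij_betw_same_card, rule bij_betw_byWitness[where f' = "\<lambda>z. z \<otimes> inv g"])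
  show "(\<lambda>z. z \<otimes> g) ` half_open (order_action G g r) a b \<subseteq> half_open r (a \<otimes> g) (b \<otimes> g)"
    by (auto simp: half_open_def order_action_def)
  show "(\<lambda>z. z \<otimes> inv g) ` half_open r (a \<otimes> g) (b \<otimes> g) \<subseteq> half_open (order_action G g r) a b"
  proof
    fix y assume "y \<in> (\<lambda>z. z \<otimes> inv g) ` half_open r (a \<otimes> g) (b \<otimes> g)"
    then obtain z where z: "z \<in> half_open r (a \<otimes> g) (b \<otimes> g)" "y = z \<otimes> inv g" by blast
    then have [simp]: "z \<in> carrier G" using r by (auto simp: half_open_def)
    have "y \<otimes> g = z" using z by (simp add: m_assoc)
    moreover have "z = b \<otimes> g \<Longrightarrow> y = b" using z by (simp add: m_assoc)
    ultimately show "y \<in> half_open (order_action G g r) a b"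
      using z by (auto simp: half_open_def order_action_def)
  qed
  show "\<forall>z\<in>half_open (order_action G g r) a b. z \<otimes> g \<otimes> inv g = z"
    by (auto simp: half_open_def order_action_def m_assoc)
  show "\<forall>z\<in>half_open r (a \<otimes> g) (b \<otimes> g). z \<otimes> inv g \<otimes> g = z"
    using r by (auto simp: half_open_def m_assoc)
qed

section \<open>Folner sets from an invariant random order\<close>

context countable_group
begin

lemma pred_pair_in_relation:
  "a \<in> carrier G \<Longrightarrow> b \<in> carrier G \<Longrightarrow> Measurable.pred (Z_order_space G) (\<lambda>r. (a, b) \<in> r)"
  using sets_pair_in_relation by (simp add: pred_def)

lemma measurable_steps:
  assumes "a \<in> carrier G" "b \<in> carrier G"
  shows "(\<lambda>r. steps r a b) \<in> measurable (Z_order_space G) (count_space UNIV)"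
proof -
  let ?M = "Z_order_space G"
  have eq: "half_open r a b = {z \<in> carrier G. (a, z) \<in> r \<and> (z, b) \<in> r\<^sup>=}" if "r \<in> Z_orders G" for r
    using Z_ordersD(2)[OF that] by (auto simp: half_open_def)
  have "(\<lambda>r. card {z \<in> carrier G. (a, z) \<in> r \<and> (z, b) \<in> r\<^sup>=}) \<in> measurable ?M (count_space UNIV)"
  proof (rule measurable_card_Collect[OF countable_carrier])
    fix z assume "z \<in> carrier G"
    then have [measurable]: "Measurable.pred ?M (\<lambda>r. (a, z) \<in> r)" "Measurable.pred ?M (\<lambda>r. (z, b) \<in> r)"
      using assms by (auto intro: pred_pair_in_relation)
    show "{r \<in> space ?M. (a, z) \<in> r \<and> (z, b) \<in> r\<^sup>=} \<in> sets ?M"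
      by (simp only: Un_iff pair_in_Id_conv) measurable
  next
    fix r assume "r \<in> space ?M"
    then show "finite {z \<in> carrier G. (a, z) \<in> r \<and> (z, b) \<in> r\<^sup>=}"
      using finite_half_open[of r G a b] eq[of r] by simp
  qed
  then show ?thesis
    by (rule measurable_cong[THEN iffD1, rotated]) (simp add: steps_def eq)
qed

text \<open>The set is a segment of length \<open>n\<close> for an order picked by averaging. Half
  of the tolerance \<open>\<epsilon>\<close> pays for the pairs at distance above \<open>L\<close>,
  the other half for the at most \<open>2 * L\<close> exits near the two ends.\<close>

lemma multiorder_ex_Folner_set:
  assumes "multiorder G \<nu>" and K: "finite K" "K \<subseteq> carrier G" and \<epsilon>: "0 < \<epsilon>"
  shows "\<exists>F. finite F \<and> F \<noteq> {} \<and> F \<subseteq> carrier G \<and>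
    (\<forall>g\<in>K. real (card {x \<in> F. g \<otimes> x \<notin> F}) \<le> \<epsilon> * real (card F))"
proof -
  interpret prob_space \<nu> using assms(1) by (simp add: multiorder_def)
  have sets_eq: "sets \<nu> = sets (Z_order_space G)"
    and act: "\<And>g. g \<in> carrier G \<Longrightarrow> order_action G g \<in> measurable \<nu> \<nu>"
    and inv: "\<And>g. g \<in> carrier G \<Longrightarrow> distr \<nu> \<nu> (order_action G g) = \<nu>"
    using assms(1) by (auto simp: multiorder_def)
  have space_eq: "space \<nu> = Z_orders G"
    using sets_eq_imp_space_eq[OF sets_eq] by simp
  have m_pair: "Measurable.pred \<nu> (\<lambda>r. (a, b) \<in> r)" if "a \<in> carrier G" "b \<in> carrier G" for a b
    using pred_pair_in_relation[OF that] by (simp add: measurable_cong_sets[OF sets_eq refl])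
  have m_steps: "(\<lambda>r. steps r a b) \<in> measurable \<nu> (count_space UNIV)"
    if "a \<in> carrier G" "b \<in> carrier G" for a b
    using measurable_steps[OF that] by (simp add: measurable_cong_sets[OF sets_eq refl])
  \<comment> \<open>Both directions are tested because \<open>steps\<close> vanishes in at least one
    of them.\<close>
  define far where "far L r a b \<longleftrightarrow> L < steps r a b \<or> L < steps r b a" for L r and a b :: 'a
  have m_far: "Measurable.pred \<nu> (\<lambda>r. far L r a b)" if "a \<in> carrier G" "b \<in> carrier G" for a b L
  proof -
    note [measurable] = m_steps[OF that] m_steps[OF that(2,1)]
    show ?thesis unfolding far_def by measurable
  qed
  define B where "B g L = {r \<in> space \<nu>. far L r \<one> g}" for g L
  have B_sets: "B g L \<in> sets \<nu>" if "g \<in> carrier G" for g L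
    using m_far[of \<one> g L] that by (simp add: B_def pred_def)
  \<comment> \<open>The events decrease in \<open>L\<close>, and their intersection is empty because
    in each order \<open>\<one>\<close> and \<open>g\<close> are at finite distance.\<close>
  have lim: "(\<lambda>L. measure \<nu> (B g L)) \<longlonglongrightarrow> 0" if "g \<in> carrier G" for g
  proof -
    have "(\<lambda>L. measure \<nu> (B g L)) \<longlonglongrightarrow> measure \<nu> (\<Inter>L. B g L)"
      using B_sets[OF that]
      by (intro finite_Lim_measure_decseq) (auto simp: decseq_def B_def far_def)
    moreover have "(\<Inter>L. B g L) = {}"
    proof (rule equals0I)
      fix r assume "r \<in> (\<Inter>L. B g L)"
      then have "r \<in> B g (max (steps r \<one> g) (steps r g \<one>))" by blast
      then show False by (simp add: B_def far_def)
    qed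
    ultimately show ?thesis by simp
  qed
  have "(\<lambda>L. \<Sum>g\<in>K. measure \<nu> (B g L)) \<longlonglongrightarrow> (\<Sum>g\<in>K. 0)"
    using lim K by (intro tendsto_sum) auto
  then have "\<forall>\<^sub>F L in sequentially. (\<Sum>g\<in>K. measure \<nu> (B g L)) < \<epsilon> / 2"
    by (rule order_tendstoD) (use \<epsilon> in simp)
  then obtain L where L: "(\<Sum>g\<in>K. measure \<nu> (B g L)) < \<epsilon> / 2"
    unfolding eventually_sequentially by blast
  \<comment> \<open>The length is taken so large that the end effects \<open>2 * L\<close> use at
    most \<open>\<epsilon> * n / 2\<close>.\<close>
  obtain n :: nat where "max 1 (4 * real L / \<epsilon>) < real n"
    using reals_Archimedean2 by blast
  then have n: "0 < n" "4 * real L \<le> \<epsilon> * real n"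
    using \<epsilon> by (auto simp: field_simps)

  \<comment> \<open>\<open>Y\<close> is \<open>X\<close> transported by \<open>x\<close>: the pair \<open>(x, g x)\<close> becomes \<open>(\<one>, g)\<close>, and the base
    point \<open>\<one>\<close> of the segment becomes \<open>inv x\<close>.\<close>
  define X where "X g r x \<longleftrightarrow> x \<in> segment G r \<one> n \<and> far L r x (g \<otimes> x)" for g r x
  define Y where "Y g r x \<longleftrightarrow> (\<one>, inv x) \<notin> r \<and> steps r (inv x) \<one> < n \<and> far L r \<one> g" for g r x
  have m_X: "Measurable.pred \<nu> (\<lambda>r. X g r x)" if "g \<in> carrier G" "x \<in> carrier G" for g x
  proof -
    note [measurable] = m_far[OF that(2), of "g \<otimes> x" L] m_pair[OF that(2) one_closed]
      m_steps[OF one_closed that(2)]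
    show ?thesis using that unfolding X_def segment_def by simp
  qed
  have m_Y: "Measurable.pred \<nu> (\<lambda>r. Y g r x)" if "g \<in> carrier G" "x \<in> carrier G" for g x
  proof -
    have "inv x \<in> carrier G" using that by simp
    note [measurable] = m_far[OF one_closed that(1), of L] m_pair[OF one_closed this]
      m_steps[OF this one_closed]
    show ?thesis unfolding Y_def by measurable
  qed
  have XY: "emeasure \<nu> {r \<in> space \<nu>. X g r x} = emeasure \<nu> {r \<in> space \<nu>. Y g r x}"
    if [simp]: "g \<in> carrier G" "x \<in> carrier G" for g x
  proof -
    have "emeasure \<nu> {r \<in> space \<nu>. Y g r x}
        = emeasure (distr \<nu> \<nu> (order_action G x)) {r \<in> space \<nu>. Y g r x}"
      by (simp add: inv)
    also have "\<dots> = emeasure \<nu> (order_action G x -` {r \<in> space \<nu>. Y g r x} \<inter> space \<nu>)"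
      using m_Y[OF that] act by (intro emeasure_distr) (auto simp: pred_def)
    also have "order_action G x -` {r \<in> space \<nu>. Y g r x} \<inter> space \<nu> = {r \<in> space \<nu>. X g r x}"
    proof -
      have "Y g (order_action G x r) x \<longleftrightarrow> X g r x" if "r \<in> space \<nu>" for r
      proof -
        have "r \<subseteq> carrier G \<times> carrier G" using that by (simp add: space_eq Z_orders_def)
        note [simp] = steps_order_action[OF this]
        have "(\<one>, inv x) \<in> order_action G x r \<longleftrightarrow> (x, \<one>) \<in> r"
          by (auto simp: order_action_def)
        then show ?thesis by (simp add: X_def Y_def far_def segment_def)
      qed
      then show ?thesis
        using measurable_space[OF act[OF that(2)]] by auto
    qed
    finally show ?thesis by simp
  qed
  \<comment> \<open>Cardinalities become integrals over counting measure, so that they can be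
    interchanged with the integral over \<open>\<nu>\<close>.\<close>
  have count: "(\<integral>\<^sup>+x. indicator {x. P x} x \<partial>count_space (carrier G)) = of_nat (card {x \<in> carrier G. P x})"
    if "finite {x \<in> carrier G. P x}" for P
  proof -
    have "(\<integral>\<^sup>+x. indicator {x. P x} x \<partial>count_space (carrier G))
        = (\<integral>\<^sup>+x. indicator {x \<in> carrier G. P x} x \<partial>count_space (carrier G))"
      by (intro nn_integral_cong) (auto simp: indicator_def)
    also have "\<dots> = emeasure (count_space (carrier G)) {x \<in> carrier G. P x}"
      by (rule nn_integral_indicator) auto
    also have "\<dots> = of_nat (card {x \<in> carrier G. P x})"
      using that by (intro emeasure_count_space_finite) auto
    finally show ?thesis .
  qed
  have X_fin: "finite {x \<in> carrier G. X g r x}" if "r \<in> space \<nu>" for g r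
    using finite_segment[of r G \<one> n] that unfolding space_eq X_def
    by (auto elim: finite_subset[rotated])
  \<comment> \<open>For fixed \<open>r\<close>, the element \<open>x\<close> is recovered from the
    distance of \<open>inv x\<close> to \<open>\<one>\<close>, which takes values below
    \<open>n\<close>.\<close>
  have Y_card: "finite {x \<in> carrier G. Y g r x}" "card {x \<in> carrier G. Y g r x} \<le> n"
    if "r \<in> space \<nu>" for g r
  proof -
    have inj: "inj_on (\<lambda>x. steps r (inv x) \<one>) {x \<in> carrier G. Y g r x}"
    proof (rule inj_onI)
      fix x y assume "x \<in> {x \<in> carrier G. Y g r x}" "y \<in> {x \<in> carrier G. Y g r x}"
        "steps r (inv x) \<one> = steps r (inv y) \<one>"
      then show "x = y"
        using steps_to_inject[of r G "inv x" "inv y" \<one>] that inj_onD[OF inv_inj, of x y]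
        by (auto simp: space_eq Y_def)
    qed
    have sub: "(\<lambda>x. steps r (inv x) \<one>) ` {x \<in> carrier G. Y g r x} \<subseteq> {..<n}"
      by (auto simp: Y_def)
    show "finite {x \<in> carrier G. Y g r x}"
      using finite_subset[OF sub] finite_imageD[OF _ inj] by simp
    show "card {x \<in> carrier G. Y g r x} \<le> n"
      using card_inj_on_le[OF inj sub] by simp
  qed
  \<comment> \<open>Mass transport: the integrals are interchanged, \<open>X\<close> is replaced by
    \<open>Y\<close> via \<open>XY\<close>, and the integrals are interchanged back. The count of
    \<open>Y\<close> is at most \<open>n\<close> and is zero outside \<open>B g L\<close>.\<close>
  have X_bound: "(\<integral>\<^sup>+r. of_nat (card {x \<in> carrier G. X g r x}) \<partial>\<nu>) \<le> ennreal (real n * measure \<nu> (B g L))"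
    if g: "g \<in> carrier G" for g
  proof -
    have "(\<integral>\<^sup>+r. of_nat (card {x \<in> carrier G. X g r x}) \<partial>\<nu>)
        = (\<integral>\<^sup>+r. \<integral>\<^sup>+x. indicator {r \<in> space \<nu>. X g r x} r \<partial>count_space (carrier G) \<partial>\<nu>)"
      by (intro nn_integral_cong) (auto simp: count[symmetric] X_fin indicator_def intro!: nn_integral_cong)
    also have "\<dots> = (\<integral>\<^sup>+x. \<integral>\<^sup>+r. indicator {r \<in> space \<nu>. X g r x} r \<partial>\<nu> \<partial>count_space (carrier G))"
      using m_X[OF g]
      by (intro nn_integral_count_space_nn_integral countable_carrier borel_measurable_indicator)
        (auto simp: pred_def)
    also have "\<dots> = (\<integral>\<^sup>+x. emeasure \<nu> {r \<in> space \<nu>. X g r x} \<partial>count_space (carrier G))"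
      using m_X[OF g] by (intro nn_integral_cong nn_integral_indicator) (auto simp: pred_def)
    also have "\<dots> = (\<integral>\<^sup>+x. emeasure \<nu> {r \<in> space \<nu>. Y g r x} \<partial>count_space (carrier G))"
      using XY[OF g] by (intro nn_integral_cong) auto
    also have "\<dots> = (\<integral>\<^sup>+x. \<integral>\<^sup>+r. indicator {r \<in> space \<nu>. Y g r x} r \<partial>\<nu> \<partial>count_space (carrier G))"
      using m_Y[OF g] by (intro nn_integral_cong nn_integral_indicator[symmetric]) (auto simp: pred_def)
    also have "\<dots> = (\<integral>\<^sup>+r. \<integral>\<^sup>+x. indicator {r \<in> space \<nu>. Y g r x} r \<partial>count_space (carrier G) \<partial>\<nu>)"
      using m_Y[OF g]
      by (intro nn_integral_count_space_nn_integral[symmetric] countable_carrier borel_measurable_indicator)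
        (auto simp: pred_def)
    also have "\<dots> = (\<integral>\<^sup>+r. of_nat (card {x \<in> carrier G. Y g r x}) \<partial>\<nu>)"
      by (intro nn_integral_cong) (auto simp: count[symmetric] Y_card indicator_def intro!: nn_integral_cong)
    also have "\<dots> \<le> (\<integral>\<^sup>+r. of_nat n * indicator (B g L) r \<partial>\<nu>)"
    proof (rule nn_integral_mono)
      fix r assume r: "r \<in> space \<nu>"
      show "of_nat (card {x \<in> carrier G. Y g r x}) \<le> of_nat n * (indicator (B g L) r :: ennreal)"
      proof (cases "r \<in> B g L")
        case True then show ?thesis using Y_card(2)[OF r] by simp
      next
        case False
        then have "{x \<in> carrier G. Y g r x} = {}" using r by (auto simp: B_def Y_def)
        then show ?thesis by (simp only: card.empty) simp
      qed
    qed
    also have "\<dots> = of_nat n * emeasure \<nu> (B g L)"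
      using B_sets[OF g] by (simp add: nn_integral_cmult_indicator)
    also have "\<dots> = ennreal (real n * measure \<nu> (B g L))"
      by (simp add: emeasure_eq_measure ennreal_mult ennreal_of_nat_eq_real_of_nat)
    finally show ?thesis .
  qed
  \<comment> \<open>First moment argument: the sum over \<open>K\<close> has expectation below
    \<open>n * \<epsilon> / 2\<close>, so a single order serves all of \<open>K\<close> at
    once.\<close>
  have "\<exists>r\<in>space \<nu>. (\<Sum>g\<in>K. real (card {x \<in> carrier G. X g r x})) < real n * (\<epsilon> / 2)"
  proof (rule ccontr)
    assume "\<not> ?thesis"
    then have *: "real n * (\<epsilon> / 2) \<le> (\<Sum>g\<in>K. real (card {x \<in> carrier G. X g r x}))" if "r \<in> space \<nu>" for r
      using that by (auto simp: not_less)
    have m_card: "(\<lambda>r. of_nat (card {x \<in> carrier G. X g r x}) :: ennreal) \<in> borel_measurable \<nu>"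
      if g: "g \<in> K" for g
    proof -
      have "(\<lambda>r. card {x \<in> carrier G. X g r x}) \<in> measurable \<nu> (count_space UNIV)"
        using m_X g K X_fin by (intro measurable_card_Collect countable_carrier) (auto simp: pred_def)
      then show ?thesis by (rule measurable_compose) simp
    qed
    have "ennreal (real n * (\<epsilon> / 2)) = (\<integral>\<^sup>+r. ennreal (real n * (\<epsilon> / 2)) \<partial>\<nu>)"
      by (simp add: emeasure_space_1)
    also have "\<dots> \<le> (\<integral>\<^sup>+r. (\<Sum>g\<in>K. of_nat (card {x \<in> carrier G. X g r x})) \<partial>\<nu>)"
    proof (rule nn_integral_mono)
      fix r assume "r \<in> space \<nu>"
      from *[OF this] show "ennreal (real n * (\<epsilon> / 2)) \<le> (\<Sum>g\<in>K. of_nat (card {x \<in> carrier G. X g r x}))"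
        by (simp add: ennreal_of_nat_eq_real_of_nat ennreal_leI)
    qed
    also have "\<dots> = (\<Sum>g\<in>K. \<integral>\<^sup>+r. of_nat (card {x \<in> carrier G. X g r x}) \<partial>\<nu>)"
      by (rule nn_integral_sum) (rule m_card)
    also have "\<dots> \<le> (\<Sum>g\<in>K. ennreal (real n * measure \<nu> (B g L)))"
      using K by (intro sum_mono X_bound) auto
    also have "\<dots> = ennreal (real n * (\<Sum>g\<in>K. measure \<nu> (B g L)))"
      by (simp add: sum_distrib_left)
    finally have "real n * (\<epsilon> / 2) \<le> real n * (\<Sum>g\<in>K. measure \<nu> (B g L))"
      by (subst (asm) ennreal_le_iff) (auto intro!: mult_nonneg_nonneg sum_nonneg)
    then show False using L n by simp
  qed
  then obtain r where r: "r \<in> space \<nu>"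
    "(\<Sum>g\<in>K. real (card {x \<in> carrier G. X g r x})) < real n * (\<epsilon> / 2)"
    by blast
  have r_Z: "r \<in> Z_orders G" using r space_eq by simp
  let ?F = "segment G r \<one> n"
  have "real (card {x \<in> ?F. g \<otimes> x \<notin> ?F}) \<le> \<epsilon> * real (card ?F)" if g: "g \<in> K" for g
  proof -
    \<comment> \<open>A point leaving the segment makes either a jump of length at most
      \<open>L\<close>, counted by \<open>card_segment_exit\<close>, or a longer one, counted by
      \<open>X\<close>.\<close>
    let ?N = "{x \<in> ?F. g \<otimes> x \<in> carrier G - ?F \<and> steps r x (g \<otimes> x) \<le> L \<and> steps r (g \<otimes> x) x \<le> L}"
    have "{x \<in> ?F. g \<otimes> x \<notin> ?F} \<subseteq> ?N \<union> {x \<in> carrier G. X g r x}"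
      using g K by (auto simp: X_def far_def segment_def)
    moreover have "finite ?N" using finite_segment[OF r_Z one_closed, of n] by simp
    ultimately have "card {x \<in> ?F. g \<otimes> x \<notin> ?F} \<le> card (?N \<union> {x \<in> carrier G. X g r x})"
      using X_fin[OF r(1)] by (intro card_mono) auto
    also have "\<dots> \<le> card ?N + card {x \<in> carrier G. X g r x}" by (rule card_Un_le)
    also have "card ?N \<le> 2 * L" by (rule card_segment_exit[OF r_Z one_closed])
    finally have "real (card {x \<in> ?F. g \<otimes> x \<notin> ?F}) \<le> 2 * real L + real (card {x \<in> carrier G. X g r x})"
      by simp
    also have "real (card {x \<in> carrier G. X g r x}) \<le> (\<Sum>g\<in>K. real (card {x \<in> carrier G. X g r x}))"
      using K g by (intro member_le_sum) auto
    finally have "real (card {x \<in> ?F. g \<otimes> x \<notin> ?F}) \<le> \<epsilon> * real n"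
      using r(2) n(2) by (simp add: algebra_simps)
    then show ?thesis by (simp add: card_segment[OF r_Z one_closed])
  qed
  moreover have "?F \<noteq> {}"
    using card_segment[OF r_Z one_closed, of n] n(1) by (metis card.empty less_irrefl)
  moreover have "finite ?F" "?F \<subseteq> carrier G"
    using finite_segment[OF r_Z one_closed, of n] by (auto simp: segment_def)
  ultimately show ?thesis by blast
qed

section \<open>From Folner sets to a Folner sequence\<close>

lemma card_Int_l_coset:
  assumes F: "finite F" "F \<subseteq> carrier G" and g: "g \<in> carrier G"
  shows "card (F \<inter> (g <#\<^bsub>G\<^esub> F)) = card {x \<in> F. g \<otimes> x \<in> F}"
proof -
  have "F \<inter> (g <#\<^bsub>G\<^esub> F) = (\<lambda>x. g \<otimes> x) ` {x \<in> F. g \<otimes> x \<in> F}"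
    by (auto simp: l_coset_def)
  moreover have "inj_on (\<lambda>x. g \<otimes> x) {x \<in> F. g \<otimes> x \<in> F}"
    using F by (intro inj_on_subset[OF inj_on_cmult[OF g]]) auto
  ultimately show ?thesis by (simp add: card_image)
qed

text \<open>Along an enumeration \<open>e\<close>, the set with index \<open>n\<close> treats
  \<open>e 0\<close>, ..., \<open>e n\<close> with tolerance \<open>1 / (n + 1)\<close>; each fixed
  element is covered from its own index on.\<close>

lemma amenableI:
  assumes "\<And>K \<epsilon>. finite K \<Longrightarrow> K \<subseteq> carrier G \<Longrightarrow> 0 < \<epsilon> \<Longrightarrow> \<exists>F. finite F \<and> F \<noteq> {} \<and> F \<subseteq> carrier G \<and>
    (\<forall>g\<in>K. real (card {x \<in> F. g \<otimes> x \<notin> F}) \<le> \<epsilon> * real (card F))"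
  shows "amenable G"
proof -
  define e where "e = from_nat_into (carrier G)"
  have e: "range e = carrier G"
    unfolding e_def by (rule range_from_nat_into) (use countable_carrier in auto)
  define Q where "Q n F \<longleftrightarrow> finite F \<and> F \<noteq> {} \<and> F \<subseteq> carrier G \<and>
    (\<forall>g\<in>e ` {..n}. real (card {x \<in> F. g \<otimes> x \<notin> F}) \<le> inverse (real (Suc n)) * real (card F))"
    for n F
  have "\<exists>F. Q n F" for n
    unfolding Q_def using e by (intro assms) auto
  then obtain F where "\<And>n. Q n (F n)" by metis
  then have F: "\<And>n. finite (F n)" "\<And>n. F n \<noteq> {}" "\<And>n. F n \<subseteq> carrier G"
    and F_inv: "\<And>n g. g \<in> e ` {..n} \<Longrightarrow>
      real (card {x \<in> F n. g \<otimes> x \<notin> F n}) \<le> inverse (real (Suc n)) * real (card (F n))"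
    unfolding Q_def by blast+
  have "(\<lambda>n. real (card (F n \<inter> (g <#\<^bsub>G\<^esub> F n))) / real (card (F n))) \<longlonglongrightarrow> 1" if g: "g \<in> carrier G" for g
  proof -
    obtain k where k: "g = e k" using e g by blast
    have ratio: "real (card (F n \<inter> (g <#\<^bsub>G\<^esub> F n))) / real (card (F n))
        = 1 - real (card {x \<in> F n. g \<otimes> x \<notin> F n}) / real (card (F n))" for n
    proof -
      have "card (F n) = card ({x \<in> F n. g \<otimes> x \<in> F n} \<union> {x \<in> F n. g \<otimes> x \<notin> F n})"
        by (rule arg_cong[where f = card]) auto
      also have "\<dots> = card {x \<in> F n. g \<otimes> x \<in> F n} + card {x \<in> F n. g \<otimes> x \<notin> F n}"
        using F(1) by (intro card_Un_disjoint) auto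
      finally have "real (card (F n \<inter> (g <#\<^bsub>G\<^esub> F n))) = real (card (F n)) - real (card {x \<in> F n. g \<otimes> x \<notin> F n})"
        using card_Int_l_coset[OF F(1,3) g] by simp
      then show ?thesis using F(1,2) by (simp add: diff_divide_distrib)
    qed
    have "(\<lambda>n. real (card {x \<in> F n. g \<otimes> x \<notin> F n}) / real (card (F n))) \<longlonglongrightarrow> 0"
    proof (rule tendsto_sandwich[OF _ _ tendsto_const LIMSEQ_inverse_real_of_nat])
      show "\<forall>\<^sub>F n in sequentially. real (card {x \<in> F n. g \<otimes> x \<notin> F n}) / real (card (F n)) \<le> inverse (real (Suc n))"
        using eventually_ge_at_top[of k]
      proof eventually_elim
        case (elim n)
        then have "g \<in> e ` {..n}" using k by auto
        then show ?case using F_inv F(1,2)[of n] by (simp add: divide_le_eq card_gt_0_iff)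
      qed
    qed simp
    then have "(\<lambda>n. 1 - real (card {x \<in> F n. g \<otimes> x \<notin> F n}) / real (card (F n))) \<longlonglongrightarrow> 1 - 0"
      by (intro tendsto_diff tendsto_const)
    then show ?thesis by (simp only: ratio diff_zero)
  qed
  then have "Folner_sequence G F" using F by (auto simp: Folner_sequence_def)
  then show ?thesis by (auto simp: amenable_def)
qed

end

section \<open>Least labels of independent uniform labels\<close>

definition iid_labels :: "'i set \<Rightarrow> ('i \<Rightarrow> real) measure" where
  "iid_labels I = (\<Pi>\<^sub>M i\<in>I. uniform_measure lborel {0..<1})"

lemma prob_space_unit_uniform: "prob_space (uniform_measure lborel {0..<1::real})"
  by (intro prob_space_uniform_measure) auto

lemma prob_space_iid_labels: "prob_space (iid_labels I)"
  unfolding iid_labels_def by (intro prob_space_PiM prob_space_unit_uniform)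

lemma space_iid_labels: "space (iid_labels I) = (\<Pi>\<^sub>E i\<in>I. UNIV)"
  by (simp add: iid_labels_def space_PiM)

lemma measurable_label:
  assumes "i \<in> I"
  shows "(\<lambda>\<omega>. \<omega> i) \<in> borel_measurable (iid_labels I)"
proof -
  have "(\<lambda>\<omega>. \<omega> i) \<in> measurable (iid_labels I) (uniform_measure lborel {0..<1})"
    unfolding iid_labels_def by (rule measurable_component_singleton[OF assms])
  then show ?thesis by (simp add: measurable_def)
qed

text \<open>Injectivity of \<open>f\<close> keeps the reindexed coordinates independent. A
  transposition gives the exchangeability in \<open>prob_least_label\<close>, right translation the
  invariance in \<open>distr_shift\<close>.\<close>

lemma
  assumes "inj_on f I" "f \<in> I \<rightarrow> I"
  shows distr_iid_labels_reindex:
      "distr (iid_labels I) (iid_labels I) (\<lambda>\<omega>. \<lambda>i\<in>I. \<omega> (f i)) = iid_labels I"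
    and measurable_iid_labels_reindex:
      "(\<lambda>\<omega>. \<lambda>i\<in>I. \<omega> (f i)) \<in> measurable (iid_labels I) (iid_labels I)"
  unfolding iid_labels_def
   apply (rule distr_PiM_reindex[OF prob_space_unit_uniform assms])
  using assms(2) by (intro measurable_restrict measurable_component_singleton) auto

text \<open>With the unit interval cut into \<open>n\<close> equal pieces, equal labels lie in a
  common piece. This has probability at most \<open>n * (1 / n)^2 = 1 / n\<close>, for every
  positive \<open>n\<close>.\<close>

lemma AE_labels_neq:
  assumes cd: "c \<in> I" "d \<in> I" "c \<noteq> d"
  shows "AE \<omega> in iid_labels I. \<omega> c \<noteq> \<omega> d"
proof -
  let ?U = "uniform_measure lborel {0..<1::real}" and ?P = "iid_labels I"
  interpret product_prob_space "\<lambda>_. ?U" I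
    by (intro product_prob_spaceI prob_space_unit_uniform)
  have AE_unit: "AE \<omega> in ?P. \<omega> c \<in> {0..<1}"
    unfolding iid_labels_def
    by (rule AE_PiM_component[OF prob_space_unit_uniform cd(1)]) (auto intro: AE_uniform_measureI)
  \<comment> \<open>Restricting to labels in \<open>{0..<1}\<close> leaves finitely many pieces to
    consider; the rest is null by \<open>AE_unit\<close>.\<close>
  let ?D = "{\<omega> \<in> space ?P. \<omega> c = \<omega> d \<and> \<omega> c \<in> {0..<1}}"
  have D: "?D \<in> sets ?P"
  proof -
    have "{\<omega> \<in> space ?P. \<omega> c = \<omega> d} \<in> sets ?P"
      using cd by (intro borel_measurable_eq measurable_label)
    moreover have "(\<lambda>\<omega>. \<omega> c) -` {0..<1} \<inter> space ?P \<in> sets ?P"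
      using cd by (intro measurable_sets[OF measurable_label]) auto
    moreover have "?D = {\<omega> \<in> space ?P. \<omega> c = \<omega> d} \<inter> ((\<lambda>\<omega>. \<omega> c) -` {0..<1} \<inter> space ?P)"
      by auto
    ultimately show ?thesis by simp
  qed
  have bound: "emeasure ?P ?D \<le> ennreal (1 / real n)" if n: "0 < n" for n :: nat
  proof -
    define J where "J j = {real j / real n..<real (Suc j) / real n}" for j :: nat
    have "?D \<subseteq> (\<Union>j<n. {\<omega> \<in> space ?P. \<forall>i\<in>{c, d}. \<omega> i \<in> J j})"
    proof
      fix \<omega> assume \<omega>: "\<omega> \<in> ?D"
      define j where "j = nat \<lfloor>real n * \<omega> c\<rfloor>"
      have le: "0 \<le> real n * \<omega> c" "real n * \<omega> c < real n" using \<omega> n by auto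
      then have "\<lfloor>real n * \<omega> c\<rfloor> < int n" "0 \<le> \<lfloor>real n * \<omega> c\<rfloor>" by linarith+
      then have j: "j < n" "real j \<le> real n * \<omega> c" "real n * \<omega> c < real (Suc j)"
        unfolding j_def by linarith+
      then have "\<omega> c \<in> J j" using n by (simp add: J_def field_simps)
      then show "\<omega> \<in> (\<Union>j<n. {\<omega> \<in> space ?P. \<forall>i\<in>{c, d}. \<omega> i \<in> J j})"
        using \<omega> j(1) by auto
    qed
    moreover have J_sets: "{\<omega> \<in> space ?P. \<forall>i\<in>{c, d}. \<omega> i \<in> J j} \<in> sets ?P" for j
    proof (rule sets.sets_Collect_finite_All)
      fix i assume "i \<in> {c, d}"
      then have "(\<lambda>\<omega>. \<omega> i) -` J j \<inter> space ?P \<in> sets ?P"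
        using cd by (intro measurable_sets[OF measurable_label]) (auto simp: J_def)
      then show "{\<omega> \<in> space ?P. \<omega> i \<in> J j} \<in> sets ?P"
        by (simp add: vimage_def Int_def conj_commute)
    qed simp
    ultimately have "emeasure ?P ?D \<le> emeasure ?P (\<Union>j<n. {\<omega> \<in> space ?P. \<forall>i\<in>{c, d}. \<omega> i \<in> J j})"
      by (intro emeasure_mono) auto
    also have "\<dots> \<le> (\<Sum>j<n. emeasure ?P {\<omega> \<in> space ?P. \<forall>i\<in>{c, d}. \<omega> i \<in> J j})"
      using J_sets by (intro emeasure_subadditive_finite) auto
    also have "\<dots> = (\<Sum>j<n. ennreal (1 / real n * (1 / real n)))"
    proof (rule sum.cong)
      fix j assume j: "j \<in> {..<n}"
      have "{0..<1} \<inter> J j = J j"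
        using j n by (auto simp: J_def field_simps intro: less_le_trans[rotated])
      moreover have "emeasure lborel (J j) = ennreal (1 / real n)"
        unfolding J_def using n
        by (subst emeasure_lborel_Ico) (auto simp: divide_right_mono diff_divide_distrib[symmetric])
      moreover have "emeasure lborel {0..<1::real} = ennreal 1"
        by (subst emeasure_lborel_Ico) auto
      ultimately have "emeasure ?U (J j) = ennreal (1 / real n) / ennreal 1"
        by (subst emeasure_uniform_measure) (auto simp: J_def)
      also have "\<dots> = ennreal (1 / real n)"
        by (subst divide_ennreal) auto
      finally have "emeasure ?U (J j) = ennreal (1 / real n)" .
      then show "emeasure ?P {\<omega> \<in> space ?P. \<forall>i\<in>{c, d}. \<omega> i \<in> J j} = ennreal (1 / real n * (1 / real n))"
        unfolding iid_labels_def using cd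
        by (subst emeasure_PiM_Collect) (auto simp: J_def simp flip: ennreal_mult)
    qed simp
    also have "\<dots> = ennreal (1 / real n)"
      using n by (simp add: ennreal_of_nat_eq_real_of_nat ennreal_mult[symmetric])
    finally show ?thesis .
  qed
  have "(\<lambda>n. ennreal (1 / real n)) \<longlonglongrightarrow> ennreal 0"
    by (intro tendsto_ennrealI lim_1_over_n)
  moreover have "\<forall>\<^sub>F n in sequentially. emeasure ?P ?D \<le> ennreal (1 / real n)"
    by (rule eventually_sequentiallyI[of 1], rule bound) simp
  ultimately have "emeasure ?P ?D \<le> ennreal 0"
    by (rule tendsto_lowerbound) simp
  then have "AE \<omega> in ?P. \<omega> \<notin> ?D"
    using D by (intro AE_not_in) (auto simp: null_sets_def)
  with AE_unit AE_space show ?thesis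
    by eventually_elim auto
qed

lemma AE_labels_inj_on:
  assumes "countable C" "C \<subseteq> I"
  shows "AE \<omega> in iid_labels I. inj_on \<omega> C"
proof -
  have "AE \<omega> in iid_labels I. c \<noteq> d \<longrightarrow> \<omega> c \<noteq> \<omega> d" if "c \<in> C" "d \<in> C" for c d
    using AE_labels_neq[of c I d] that assms(2) by (cases "c = d") auto
  then have "AE \<omega> in iid_labels I. \<forall>c\<in>C. \<forall>d\<in>C. c \<noteq> d \<longrightarrow> \<omega> c \<noteq> \<omega> d"
    by (intro AE_ball_countable' assms(1))
  then show ?thesis by eventually_elim (auto simp: inj_on_def)
qed

text \<open>By exchangeability all elements of \<open>C\<close> are equally likely to carry the
  least label. These events are disjoint and, as ties have probability 0, exhaust the space almost
  surely.\<close>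

lemma prob_least_label:
  assumes C: "finite C" "C \<subseteq> I" "c \<in> C"
  shows "measure (iid_labels I) {\<omega> \<in> space (iid_labels I). \<forall>d\<in>C - {c}. \<omega> c < \<omega> d} = 1 / real (card C)"
proof -
  let ?P = "iid_labels I"
  interpret prob_space ?P by (rule prob_space_iid_labels)
  define E where "E c = {\<omega> \<in> space ?P. \<forall>d\<in>C - {c}. \<omega> c < \<omega> d}" for c
  have E_sets: "E c \<in> sets ?P" if "c \<in> C" for c
  proof -
    have "{\<omega> \<in> space ?P. \<omega> c < \<omega> d} \<in> sets ?P" if "d \<in> C" for d
      using \<open>c \<in> C\<close> that C by (intro borel_measurable_less measurable_label) auto
    then show ?thesis
      unfolding E_def using C by (intro sets.sets_Collect_finite_All) auto
  qed
  have same: "prob (E c') = prob (E c)" if c': "c' \<in> C" for c'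
  proof -
    \<comment> \<open>The swap preserves \<open>C\<close> and \<open>I\<close>, and the reindexing
      by it pulls \<open>E c'\<close> back to \<open>E c\<close>.\<close>
    let ?\<tau> = "Transposition.transpose c c'"
    have \<tau>: "inj_on ?\<tau> I" "?\<tau> \<in> I \<rightarrow> I"
      using C c' by (auto simp: Transposition.transpose_def inj_on_def split: if_splits)
    have "prob (E c') = measure (distr ?P ?P (\<lambda>\<omega>. \<lambda>i\<in>I. \<omega> (?\<tau> i))) (E c')"
      by (simp add: distr_iid_labels_reindex[OF \<tau>])
    also have "\<dots> = prob ((\<lambda>\<omega>. \<lambda>i\<in>I. \<omega> (?\<tau> i)) -` E c' \<inter> space ?P)"
      by (intro measure_distr measurable_iid_labels_reindex \<tau> E_sets c')
    also have "(\<lambda>\<omega>. \<lambda>i\<in>I. \<omega> (?\<tau> i)) -` E c' \<inter> space ?P = E c"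
    proof -
      have "(\<forall>d\<in>C - {c'}. \<omega> c < \<omega> (?\<tau> d)) \<longleftrightarrow> (\<forall>d\<in>C - {c}. \<omega> c < \<omega> d)" for \<omega> :: "'a \<Rightarrow> real"
      proof -
        have "?\<tau> ` (C - {c'}) = C - {c}"
          using C c' by (auto simp: Transposition.transpose_def image_iff split: if_splits)
        then show ?thesis by (metis imageE imageI)
      qed
      moreover have "d \<in> C \<Longrightarrow> d \<in> I" for d using C by auto
      ultimately show ?thesis
        using c' by (auto simp: E_def space_iid_labels PiE_def extensional_def)
    qed
    finally show ?thesis .
  qed
  have "disjoint_family_on E C"
    unfolding disjoint_family_on_def
  proof (intro ballI impI)
    fix c d assume "c \<in> C" "d \<in> C" "c \<noteq> d"
    show "E c \<inter> E d = {}"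
    proof (rule equals0I)
      fix \<omega> assume "\<omega> \<in> E c \<inter> E d"
      then have "\<omega> c < \<omega> d" "\<omega> d < \<omega> c"
        using \<open>c \<in> C\<close> \<open>d \<in> C\<close> \<open>c \<noteq> d\<close> by (auto simp: E_def)
      then show False by simp
    qed
  qed
  then have "prob (\<Union>c\<in>C. E c) = (\<Sum>c\<in>C. prob (E c))"
    using E_sets C by (intro finite_measure_finite_Union) auto
  also have "\<dots> = real (card C) * prob (E c)"
    using same by simp
  also have "prob (\<Union>c\<in>C. E c) = 1"
  proof (subst prob_eq_1)
    show "(\<Union>c\<in>C. E c) \<in> events" using E_sets C by (intro sets.finite_UN) auto
    have "AE \<omega> in ?P. inj_on \<omega> C"
      using C by (intro AE_labels_inj_on countable_finite)
    with AE_space show "AE \<omega> in ?P. \<omega> \<in> (\<Union>c\<in>C. E c)"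
    proof eventually_elim
      case (elim \<omega>)
      obtain c where c: "c \<in> C" "\<And>d. d \<in> C \<Longrightarrow> \<omega> c \<le> \<omega> d"
        using ex_min_if_finite[of "\<omega> ` C"] C by (auto simp: not_less)
      then have "\<omega> \<in> E c" using elim by (auto simp: E_def order.strict_iff_order dest: inj_onD)
      then show ?case using c by blast
    qed
  qed
  finally have "1 = real (card C) * prob (E c)" .
  moreover have "card C \<noteq> 0" using C by auto
  ultimately have "prob (E c) = 1 / real (card C)" by (simp add: field_simps)
  then show ?thesis by (simp add: E_def)
qed

text \<open>A least label on \<open>A \<union> B\<close> attained in \<open>A \<inter> B\<close> is
  the minimum over both sets. Different minima thus force its position into the symmetric
  difference, and each position has probability \<open>1 / card (A \<union> B)\<close>.\<close>

lemma prob_Min_labels_neq: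
  assumes AB: "finite A" "finite B" "A \<noteq> {}" "B \<noteq> {}" "A \<subseteq> I" "B \<subseteq> I"
  shows "measure (iid_labels I) {\<omega> \<in> space (iid_labels I). Min (\<omega> ` A) \<noteq> Min (\<omega> ` B)}
    \<le> real (card (A - B) + card (B - A)) / real (card (A \<union> B))"
proof -
  let ?P = "iid_labels I" and ?C = "A \<union> B"
  interpret prob_space ?P by (rule prob_space_iid_labels)
  define E where "E c = {\<omega> \<in> space ?P. \<forall>d\<in>?C - {c}. \<omega> c < \<omega> d}" for c
  let ?S = "(A - B) \<union> (B - A)"
  have prob_E: "prob (E c) = 1 / real (card ?C)" if "c \<in> ?C" for c
    unfolding E_def using AB that by (intro prob_least_label) auto
  \<comment> \<open>A non-measurable set has \<open>measure\<close> 0, so the nonzero value in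
    \<open>prob_E\<close> already yields measurability.\<close>
  have E_sets: "E c \<in> events" if "c \<in> ?C" for c
    using prob_E[OF that] measure_notin_sets[of "E c" ?P] AB that by auto
  have AE: "AE \<omega> in ?P. inj_on \<omega> ?C"
    using AB by (intro AE_labels_inj_on countable_finite) auto
  have "prob {\<omega> \<in> space ?P. Min (\<omega> ` A) \<noteq> Min (\<omega> ` B)} \<le> prob (\<Union>c\<in>?S. E c)"
  proof (rule finite_measure_mono_AE)
    show "AE \<omega> in ?P. \<omega> \<in> {\<omega> \<in> space ?P. Min (\<omega> ` A) \<noteq> Min (\<omega> ` B)} \<longrightarrow> \<omega> \<in> (\<Union>c\<in>?S. E c)"
      using AE
    proof eventually_elim
      case (elim \<omega>)
      obtain c where c: "c \<in> ?C" "\<And>d. d \<in> ?C \<Longrightarrow> \<omega> c \<le> \<omega> d"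
        using ex_min_if_finite[of "\<omega> ` ?C"] AB by (auto simp: not_less)
      show ?case
      proof (intro impI)
        assume \<omega>: "\<omega> \<in> {\<omega> \<in> space ?P. Min (\<omega> ` A) \<noteq> Min (\<omega> ` B)}"
        have "\<omega> \<in> E c" using c elim \<omega> by (auto simp: E_def order.strict_iff_order dest: inj_onD)
        moreover have "\<not> (c \<in> A \<and> c \<in> B)"
        proof
          assume "c \<in> A \<and> c \<in> B"
          then have "Min (\<omega> ` A) = \<omega> c" "Min (\<omega> ` B) = \<omega> c"
            using c AB by (auto intro!: Min_eqI)
          then show False using \<omega> by simp
        qed
        ultimately show "\<omega> \<in> (\<Union>c\<in>?S. E c)" using c by blast
      qed
    qed
    show "(\<Union>c\<in>?S. E c) \<in> events" using E_sets AB by (intro sets.finite_UN) auto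
  qed
  also have "\<dots> \<le> (\<Sum>c\<in>?S. prob (E c))"
    using E_sets AB by (intro finite_measure_subadditive_finite) auto
  also have "\<dots> = (\<Sum>c\<in>?S. 1 / real (card ?C))"
    by (intro sum.cong prob_E) auto
  also have "\<dots> = real (card ?S) / real (card ?C)"
    by simp
  also have "card ?S = card (A - B) + card (B - A)"
    using AB by (intro card_Un_disjoint) auto
  finally show ?thesis .
qed

section \<open>The multiorder of a sequence of Folner sets\<close>

text \<open>Any \<open>n\<close> of the events have total probability \<open>n * p\<close>, which
  cannot exceed 1.\<close>

lemma (in prob_space) prob_eq_0_if_infinite_disjoint:
  assumes "infinite A" "\<And>g. g \<in> A \<Longrightarrow> N g \<in> events" "disjoint_family_on N A"
    and p: "\<And>g. g \<in> A \<Longrightarrow> prob (N g) = p"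
  shows "p = 0"
proof (rule ccontr)
  assume "p \<noteq> 0"
  obtain g where "g \<in> A" using assms(1) infinite_imp_nonempty by blast
  then have "0 < p" using p[of g] measure_nonneg[of M "N g"] \<open>p \<noteq> 0\<close> by linarith
  obtain n :: nat where n: "1 / p < real n" using reals_Archimedean2 by blast
  obtain S where S: "S \<subseteq> A" "finite S" "card S = n"
    using infinite_arbitrarily_large[OF assms(1)] by blast
  have "real n * p = (\<Sum>g\<in>S. prob (N g))"
    using S p by (simp add: subset_iff)
  also have "\<dots> = prob (\<Union>g\<in>S. N g)"
    using S assms(2)
    by (intro finite_measure_finite_Union[symmetric] disjoint_family_on_mono[OF S(1) assms(3)]) auto
  also have "\<dots> \<le> 1" by simp
  finally show False using n \<open>0 < p\<close> by (simp add: field_simps)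
qed

section \<open>Fast Folner sequences and the action on orders of type Z\<close>

context countable_group
begin

text \<open>The sets are selected from a Folner sequence so that \<open>T (k + 1)\<close> has defect
  below \<open>(1 / 2) ^ k\<close> for the first \<open>k + 1\<close> elements of an enumeration.
  Summability prepares for Borel--Cantelli.\<close>

lemma amenable_summable_Folner:
  assumes "amenable G"
  shows "\<exists>T. T 0 = {\<one>} \<and> (\<forall>k. finite (T k) \<and> T k \<noteq> {} \<and> T k \<subseteq> carrier G) \<and>
    (\<forall>g\<in>carrier G. summable (\<lambda>k. 1 - real (card (T k \<inter> (g <#\<^bsub>G\<^esub> T k))) / real (card (T k))))"
proof -
  obtain F where F: "\<And>n. finite (F n) \<and> F n \<noteq> {} \<and> F n \<subseteq> carrier G"
    and lim: "\<And>g. g \<in> carrier G \<Longrightarrow>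
      (\<lambda>n. real (card (F n \<inter> (g <#\<^bsub>G\<^esub> F n))) / real (card (F n))) \<longlonglongrightarrow> 1"
    using assms by (auto simp: amenable_def Folner_sequence_def)
  define ratio where "ratio g S = real (card (S \<inter> (g <#\<^bsub>G\<^esub> S))) / real (card S)" for g and S :: "'a set"
  define e where "e = from_nat_into (carrier G)"
  have e: "range e = carrier G"
    unfolding e_def by (rule range_from_nat_into) (use countable_carrier in auto)
  have "\<exists>n. \<forall>i\<le>k. 1 - (1 / 2) ^ k < ratio (e i) (F n)" for k :: nat
  proof -
    have "\<forall>\<^sub>F n in sequentially. 1 - (1 / 2) ^ k < ratio (e i) (F n)" for i
      unfolding ratio_def using e by (intro order_tendstoD(1)[OF lim]) auto
    then have "\<forall>\<^sub>F n in sequentially. \<forall>i\<in>{..k}. 1 - (1 / 2) ^ k < ratio (e i) (F n)"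
      by (intro eventually_ball_finite) auto
    then have "\<exists>n. \<forall>i\<in>{..k}. 1 - (1 / 2) ^ k < ratio (e i) (F n)"
      unfolding eventually_sequentially by blast
    then show ?thesis by auto
  qed
  then obtain \<nu> where \<nu>: "\<And>k i. i \<le> k \<Longrightarrow> 1 - (1 / 2) ^ k < ratio (e i) (F (\<nu> k))"
    by metis
  \<comment> \<open>\<open>{\<one>}\<close> is prepended so that at level 0 each point sees only its
    own label, which separates points in \<open>label_order_total\<close>; one extra term leaves
    summability unchanged.\<close>
  define T where "T k = (case k of 0 \<Rightarrow> {\<one>} | Suc j \<Rightarrow> F (\<nu> j))" for k
  have "summable (\<lambda>k. 1 - ratio g (T k))" if g: "g \<in> carrier G" for g
  proof -
    obtain i where i: "g = e i" using e g by blast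
    have "norm (1 - ratio g (T (Suc k))) \<le> (1 / 2) ^ k" if "i \<le> k" for k
    proof -
      have "ratio g (T (Suc k)) \<le> 1"
        unfolding ratio_def T_def using F[of "\<nu> k"]
        by (auto simp: divide_le_eq card_gt_0_iff intro: card_mono)
      then show ?thesis using \<nu>[OF that] by (simp add: i T_def)
    qed
    then have "summable (\<lambda>k. 1 - ratio g (T (Suc k)))"
      by (intro summable_comparison_test[OF exI[of _ i] summable_geometric[of "1 / 2"]]) auto
    then show ?thesis by (subst (asm) summable_Suc_iff)
  qed
  moreover have "T 0 = {\<one>}" "\<And>k. finite (T k) \<and> T k \<noteq> {} \<and> T k \<subseteq> carrier G"
    using F by (auto simp: T_def split: nat.split)
  ultimately show ?thesis unfolding ratio_def by blast
qed

lemma order_action_Z_orders: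
  assumes r: "r \<in> Z_orders G" and g: "g \<in> carrier G"
  shows "order_action G g r \<in> Z_orders G"
  unfolding Z_orders_def
proof (intro CollectI conjI allI impI ballI)
  note Z = Z_ordersD[OF r]
  let ?r = "order_action G g r"
  have iff: "(a, b) \<in> ?r \<longleftrightarrow> a \<in> carrier G \<and> b \<in> carrier G \<and> (a \<otimes> g, b \<otimes> g) \<in> r" for a b
    by (auto simp: order_action_def)
  show "?r \<subseteq> carrier G \<times> carrier G" by (auto simp: order_action_def)
  show "strict_linear_order_on (carrier G) ?r"
    unfolding strict_linear_order_on_def
  proof (intro conjI)
    show "trans ?r" by (rule transI) (auto simp: iff intro: Z(4))
    show "irrefl ?r" by (auto simp: irrefl_def iff Z(3))
    show "total_on (carrier G) ?r"
      using Z(5) g by (auto simp: total_on_def iff)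
  qed
  fix a b assume ab: "(a, b) \<in> ?r"
  have "(\<lambda>x. x \<otimes> g) ` order_interval (carrier G) ?r a b
      \<subseteq> order_interval (carrier G) r (a \<otimes> g) (b \<otimes> g)"
    using g by (auto simp: order_interval_def iff)
  moreover have "finite (order_interval (carrier G) r (a \<otimes> g) (b \<otimes> g))"
    using ab Z(8) by (simp add: iff)
  ultimately have "finite ((\<lambda>x. x \<otimes> g) ` order_interval (carrier G) ?r a b)"
    by (rule finite_subset)
  moreover have "inj_on (\<lambda>x. x \<otimes> g) (order_interval (carrier G) ?r a b)"
    using ab g by (auto simp: inj_on_def order_interval_def iff)
  ultimately show "finite (order_interval (carrier G) ?r a b)"
    by (rule finite_imageD)
next
  fix x assume x: "x \<in> carrier G"
  note Z = Z_ordersD[OF r]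
  have cancel: "y \<otimes> inv g \<otimes> g = y" if "y \<in> carrier G" for y
    using g that by (simp add: m_assoc)
  obtain y where y: "(y, x \<otimes> g) \<in> r" using Z(7) x g by blast
  then have "(y \<otimes> inv g, x) \<in> order_action G g r"
    using Z(1)[OF y] x g by (auto simp: order_action_def cancel)
  then show "\<exists>a\<in>carrier G. (a, x) \<in> order_action G g r" by (auto simp: order_action_def)
  obtain y where y: "(x \<otimes> g, y) \<in> r" using Z(6) x g by blast
  then have "(x, y \<otimes> inv g) \<in> order_action G g r"
    using Z(2)[OF y] x g by (auto simp: order_action_def cancel)
  then show "\<exists>b\<in>carrier G. (x, b) \<in> order_action G g r" by (auto simp: order_action_def)
qed

lemma measurable_order_action:
  assumes g: "g \<in> carrier G"
  shows "order_action G g \<in> measurable (Z_order_space G) (Z_order_space G)"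
proof (rule measurable_Z_order_space)
  fix a b assume ab: "a \<in> carrier G" "b \<in> carrier G"
  then have "{r \<in> space (Z_order_space G). (a, b) \<in> order_action G g r}
      = {r \<in> Z_orders G. (a \<otimes> g, b \<otimes> g) \<in> r}"
    by (auto simp: order_action_def)
  then show "{r \<in> space (Z_order_space G). (a, b) \<in> order_action G g r} \<in> sets (Z_order_space G)"
    using sets_pair_in_relation[of "a \<otimes> g" "b \<otimes> g"] ab g by simp
qed (use order_action_Z_orders g in auto)

end

section \<open>The hierarchical order of a labelling\<close>

locale Folner_hierarchy = countable_group +
  fixes T :: "nat \<Rightarrow> 'a set"
  assumes infinite_carrier: "infinite (carrier G)"
    and T_0: "T 0 = {\<one>}"
    and T: "\<And>k. finite (T k)" "\<And>k. T k \<noteq> {}" "\<And>k. T k \<subseteq> carrier G"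
    and T_summable: "\<And>g. g \<in> carrier G \<Longrightarrow>
      summable (\<lambda>k. 1 - real (card (T k \<inter> (g <#\<^bsub>G\<^esub> T k))) / real (card (T k)))"
begin

abbreviation "I \<equiv> (UNIV :: nat set) \<times> carrier G"
abbreviation "P \<equiv> iid_labels I"

sublocale P: prob_space P by (rule prob_space_iid_labels)

text \<open>The tag \<open>k\<close> gives each level its own independent labels. Inverses are taken
  so that the overlap for \<open>x\<close> and \<open>y\<close> is governed by \<open>T k\<close>
  and its left translate by \<open>y \<otimes> inv x\<close>, as in the Folner condition.\<close>

definition nbhd :: "nat \<Rightarrow> 'a \<Rightarrow> (nat \<times> 'a) set" where
  "nbhd k x = (\<lambda>t. (k, inv t \<otimes> x)) ` T k"

text \<open>Comparing least labels instead of the points carrying them makes the order below transitive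
  for every labelling; for an injective labelling equal minima mean equal points.\<close>

definition cell_label :: "(nat \<times> 'a \<Rightarrow> real) \<Rightarrow> nat \<Rightarrow> 'a \<Rightarrow> real" where
  "cell_label \<omega> k x = Min (\<omega> ` nbhd k x)"

definition label_order :: "(nat \<times> 'a \<Rightarrow> real) \<Rightarrow> 'a rel" where
  "label_order \<omega> = {(x, y) \<in> carrier G \<times> carrier G.
     \<exists>k. cell_label \<omega> k x < cell_label \<omega> k y \<and> (\<forall>j>k. cell_label \<omega> j x = cell_label \<omega> j y)}"

text \<open>The restriction keeps the shifted labelling in the extensional function space underlying
  \<open>P\<close>.\<close>

definition shift :: "'a \<Rightarrow> (nat \<times> 'a \<Rightarrow> real) \<Rightarrow> nat \<times> 'a \<Rightarrow> real" where
  "shift g \<omega> = (\<lambda>i\<in>I. \<omega> (fst i, snd i \<otimes> g))"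

text \<open>Injectivity separates points at level 0 and bounds the cells; eventual agreement
  provides a highest level of disagreement for two distinct points.\<close>

definition generic :: "(nat \<times> 'a \<Rightarrow> real) \<Rightarrow> bool" where
  "generic \<omega> \<longleftrightarrow> inj_on \<omega> I \<and>
     (\<forall>x\<in>carrier G. \<forall>y\<in>carrier G. \<forall>\<^sub>F k in sequentially. cell_label \<omega> k x = cell_label \<omega> k y)"

lemma nbhd:
  assumes "x \<in> carrier G"
  shows "finite (nbhd k x)" "nbhd k x \<noteq> {}" "nbhd k x \<subseteq> I"
  using T[of k] assms by (auto simp: nbhd_def)

lemma countable_I: "countable I"
  using countable_carrier by (intro countable_SIGMA) auto

lemma measurable_cell_label:
  assumes "x \<in> carrier G"
  shows "(\<lambda>\<omega>. cell_label \<omega> k x) \<in> borel_measurable P"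
proof -
  have "(\<lambda>\<omega>. Min ((\<lambda>i. \<omega> i) ` nbhd k x)) \<in> borel_measurable P"
    using nbhd[OF assms] by (intro borel_measurable_Min measurable_label) auto
  then show ?thesis by (simp add: cell_label_def)
qed

lemma sets_pair_in_label_order: "{\<omega> \<in> space P. (x, y) \<in> label_order \<omega>} \<in> sets P"
proof (cases "x \<in> carrier G \<and> y \<in> carrier G")
  case True
  then have "{\<omega> \<in> space P. (x, y) \<in> label_order \<omega>} = {\<omega> \<in> space P.
      \<exists>k. cell_label \<omega> k x < cell_label \<omega> k y \<and> (\<forall>j\<in>{k<..}. cell_label \<omega> j x = cell_label \<omega> j y)}"
    by (auto simp: label_order_def)
  also have "\<dots> \<in> sets P"
    using True
    by (intro sets.sets_Collect_countable_Ex sets.sets_Collect_conj sets.sets_Collect_countable_Ball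
        borel_measurable_less borel_measurable_eq measurable_cell_label) auto
  finally show ?thesis .
next
  case False
  then have "{\<omega> \<in> space P. (x, y) \<in> label_order \<omega>} = {}" by (auto simp: label_order_def)
  then show ?thesis by (simp only: sets.empty_sets)
qed

text \<open>Neighbourhoods arise by left multiplication and shifts by right multiplication, and the
  two commute.\<close>

lemma cell_label_shift:
  assumes "g \<in> carrier G" "x \<in> carrier G"
  shows "cell_label (shift g \<omega>) k x = cell_label \<omega> k (x \<otimes> g)"
proof -
  have "shift g \<omega> (k, inv t \<otimes> x) = \<omega> (k, inv t \<otimes> (x \<otimes> g))" if "t \<in> T k" for t
  proof -
    have "t \<in> carrier G" using T(3) that by blast
    then show ?thesis using assms by (simp add: shift_def m_assoc)
  qed
  then have "shift g \<omega> ` nbhd k x = \<omega> ` nbhd k (x \<otimes> g)"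
    by (simp add: nbhd_def image_image)
  then show ?thesis by (simp add: cell_label_def)
qed

lemma label_order_shift:
  assumes "g \<in> carrier G"
  shows "label_order (shift g \<omega>) = order_action G g (label_order \<omega>)"
  using assms by (auto simp: label_order_def order_action_def cell_label_shift)

lemma
  assumes "g \<in> carrier G"
  shows distr_shift: "distr P P (shift g) = P" and measurable_shift: "shift g \<in> measurable P P"
proof -
  let ?f = "\<lambda>i. (fst i, snd i \<otimes> g)"
  have f: "inj_on ?f I" "?f \<in> I \<rightarrow> I"
    using assms by (auto simp: inj_on_def)
  have "shift g = (\<lambda>\<omega>. \<lambda>i\<in>I. \<omega> (?f i))" by (simp add: shift_def fun_eq_iff)
  then show "distr P P (shift g) = P" "shift g \<in> measurable P P"
    using distr_iid_labels_reindex[OF f] measurable_iid_labels_reindex[OF f] by simp_all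
qed

text \<open>At the larger of the two deciding levels one comparison is strict and the other is
  strict or an equality; above it all three labels agree.\<close>

lemma label_order_trans: "(x, y) \<in> label_order \<omega> \<Longrightarrow> (y, z) \<in> label_order \<omega> \<Longrightarrow> (x, z) \<in> label_order \<omega>"
proof -
  assume "(x, y) \<in> label_order \<omega>" "(y, z) \<in> label_order \<omega>"
  then obtain k l where c: "x \<in> carrier G" "z \<in> carrier G"
    and k: "cell_label \<omega> k x < cell_label \<omega> k y" "\<And>j. j > k \<Longrightarrow> cell_label \<omega> j x = cell_label \<omega> j y"
    and l: "cell_label \<omega> l y < cell_label \<omega> l z" "\<And>j. j > l \<Longrightarrow> cell_label \<omega> j y = cell_label \<omega> j z"
    by (auto simp: label_order_def)
  have "cell_label \<omega> (max k l) x < cell_label \<omega> (max k l) z"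
    using k l by (cases k l rule: linorder_cases) (auto simp: max_def)
  moreover have "\<forall>j>max k l. cell_label \<omega> j x = cell_label \<omega> j z"
    using k l by simp
  ultimately show ?thesis using c by (auto simp: label_order_def)
qed

lemma label_order_irrefl: "(x, x) \<notin> label_order \<omega>"
  by (auto simp: label_order_def)

text \<open>The levels of disagreement form a finite set by genericity, and level 0 belongs to it
  because \<open>T 0 = {\<one>}\<close> and labels are injective. The maximum of this set
  decides.\<close>

lemma label_order_total:
  assumes "generic \<omega>" and xy: "x \<in> carrier G" "y \<in> carrier G" "x \<noteq> y"
  shows "(x, y) \<in> label_order \<omega> \<or> (y, x) \<in> label_order \<omega>"
proof -
  define S where "S = {k. cell_label \<omega> k x \<noteq> cell_label \<omega> k y}"
  have S_iff: "k \<in> S \<longleftrightarrow> cell_label \<omega> k x \<noteq> cell_label \<omega> k y" for k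
    by (simp add: S_def)
  have "\<forall>\<^sub>F k in sequentially. cell_label \<omega> k x = cell_label \<omega> k y"
    using assms by (simp add: generic_def)
  then obtain M where "\<And>k. k \<ge> M \<Longrightarrow> cell_label \<omega> k x = cell_label \<omega> k y"
    unfolding eventually_sequentially by blast
  then have "S \<subseteq> {..<M}" by (force simp: S_iff not_le[symmetric])
  then have fin: "finite S" by (rule finite_subset) simp
  have "cell_label \<omega> 0 z = \<omega> (0, z)" if "z \<in> carrier G" for z
    using that by (simp add: cell_label_def nbhd_def T_0)
  moreover have "\<omega> (0, x) \<noteq> \<omega> (0, y)"
    using assms inj_onD[of \<omega> I "(0, x)" "(0, y)"] by (auto simp: generic_def)
  ultimately have "0 \<in> S" using xy by (simp add: S_iff)
  then have "Max S \<in> S" using fin by (intro Max_in) auto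
  moreover have "j \<notin> S" if "j > Max S" for j
    using Max_ge[OF fin, of j] that by linarith
  ultimately obtain m where max: "cell_label \<omega> m x \<noteq> cell_label \<omega> m y"
    "\<And>j. j > m \<Longrightarrow> cell_label \<omega> j x = cell_label \<omega> j y"
    unfolding S_iff by blast
  then show ?thesis
    using xy by (cases "cell_label \<omega> m x" "cell_label \<omega> m y" rule: linorder_cases)
      (auto simp: label_order_def)
qed

text \<open>Injective labels turn equal minima into a common point
  \<open>c = inv s \<otimes> a\<close>, and every \<open>z\<close> in the cell is
  \<open>t \<otimes> c\<close> for some \<open>t \<in> T k\<close>.\<close>

lemma finite_cell:
  assumes "generic \<omega>" "a \<in> carrier G"
  shows "finite {z \<in> carrier G. cell_label \<omega> k z = cell_label \<omega> k a}"
proof -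
  have min: "\<exists>t\<in>T k. cell_label \<omega> k z = \<omega> (k, inv t \<otimes> z)" if "z \<in> carrier G" for z
  proof -
    have "cell_label \<omega> k z \<in> \<omega> ` nbhd k z"
      unfolding cell_label_def using nbhd[OF that] by (intro Min_in) auto
    then show ?thesis by (auto simp: nbhd_def)
  qed
  obtain s where s: "s \<in> T k" "cell_label \<omega> k a = \<omega> (k, inv s \<otimes> a)" using min assms by blast
  have "{z \<in> carrier G. cell_label \<omega> k z = cell_label \<omega> k a} \<subseteq> (\<lambda>t. t \<otimes> (inv s \<otimes> a)) ` T k"
  proof
    fix z assume z: "z \<in> {z \<in> carrier G. cell_label \<omega> k z = cell_label \<omega> k a}"
    then obtain t where t: "t \<in> T k" "cell_label \<omega> k z = \<omega> (k, inv t \<otimes> z)" using min by blast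
    have [simp]: "s \<in> carrier G" "t \<in> carrier G" "z \<in> carrier G" using s t z T(3) by auto
    have "\<omega> (k, inv t \<otimes> z) = \<omega> (k, inv s \<otimes> a)" using s t z by simp
    then have "(k, inv t \<otimes> z) = (k, inv s \<otimes> a)"
      using assms by (intro inj_onD[of \<omega> I]) (auto simp: generic_def)
    then have "t \<otimes> (inv s \<otimes> a) = t \<otimes> (inv t \<otimes> z)" by simp
    also have "\<dots> = z" by (simp add: m_assoc[symmetric])
    finally show "z \<in> (\<lambda>t. t \<otimes> (inv s \<otimes> a)) ` T k" using t by blast
  qed
  then show ?thesis using T(1) finite_subset by blast
qed

text \<open>From some level \<open>k\<close> on, \<open>a\<close> and \<open>b\<close> have equal
  labels. An element in between that differs from \<open>a\<close> at a level \<open>\<ge> k\<close>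
  would force \<open>a\<close> and \<open>b\<close> to differ at such a level, so all elements in
  between lie in the finite level \<open>k\<close> cell of \<open>a\<close>.\<close>

lemma finite_label_order_interval:
  assumes "generic \<omega>" and ab: "(a, b) \<in> label_order \<omega>"
  shows "finite (order_interval (carrier G) (label_order \<omega>) a b)"
proof -
  have c: "a \<in> carrier G" "b \<in> carrier G" using ab by (auto simp: label_order_def)
  then have "\<forall>\<^sub>F j in sequentially. cell_label \<omega> j a = cell_label \<omega> j b"
    using assms(1) by (simp add: generic_def)
  then obtain k where k: "\<And>j. j \<ge> k \<Longrightarrow> cell_label \<omega> j a = cell_label \<omega> j b"
    unfolding eventually_sequentially by blast
  have "cell_label \<omega> k z = cell_label \<omega> k a"
    if z: "(a, z) \<in> label_order \<omega>" "(z, b) \<in> label_order \<omega>" for z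
  proof -
    obtain p q where p: "cell_label \<omega> p a < cell_label \<omega> p z" "\<And>j. j > p \<Longrightarrow> cell_label \<omega> j a = cell_label \<omega> j z"
      and q: "cell_label \<omega> q z < cell_label \<omega> q b" "\<And>j. j > q \<Longrightarrow> cell_label \<omega> j z = cell_label \<omega> j b"
      using z by (auto simp: label_order_def)
    have "p < k"
    proof (rule ccontr)
      assume "\<not> p < k"
      then show False
        using p q k[of p] k[of q] by (cases p q rule: linorder_cases) auto
    qed
    then show ?thesis using p by simp
  qed
  then have "order_interval (carrier G) (label_order \<omega>) a b
      \<subseteq> insert b {z \<in> carrier G. cell_label \<omega> k z = cell_label \<omega> k a}"
    using c by (auto simp: order_interval_def)
  then show ?thesis using finite_cell[OF assms(1) c(1)] finite_subset by blast
qed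

section \<open>Almost sure genericity\<close>

text \<open>With \<open>g = y \<otimes> inv x\<close>, the two neighbourhoods share at least as many
  points as \<open>T k\<close> and its translate by \<open>g\<close>. This bounds their symmetric
  difference, while their union has at least \<open>card (T k)\<close> points.\<close>

lemma prob_cell_label_neq:
  assumes xy: "x \<in> carrier G" "y \<in> carrier G"
  shows "P.prob {\<omega> \<in> space P. cell_label \<omega> k x \<noteq> cell_label \<omega> k y}
    \<le> 2 * (1 - real (card (T k \<inter> ((y \<otimes> inv x) <#\<^bsub>G\<^esub> T k))) / real (card (T k)))"
proof -
  define g where "g = y \<otimes> inv x"
  have g: "g \<in> carrier G" using xy by (simp add: g_def)
  let ?A = "nbhd k x" and ?B = "nbhd k y" and ?R = "T k \<inter> (g <#\<^bsub>G\<^esub> T k)"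
  have inj: "inj_on (\<lambda>t. (k, inv t \<otimes> z)) (T k)" if "z \<in> carrier G" for z
  proof (rule inj_onI)
    fix s t assume "s \<in> T k" "t \<in> T k" and eq: "(k, inv s \<otimes> z) = (k, inv t \<otimes> z)"
    then have "s \<in> carrier G" "t \<in> carrier G" using T(3) by auto
    then show "s = t" using eq that inj_onD[OF inv_inj, of s t] by auto
  qed
  have card: "card (nbhd k z) = card (T k)" if "z \<in> carrier G" for z
    unfolding nbhd_def by (rule card_image[OF inj[OF that]])
  have sub: "(\<lambda>t. (k, inv t \<otimes> y)) ` ?R \<subseteq> ?A \<inter> ?B"
  proof
    fix i assume "i \<in> (\<lambda>t. (k, inv t \<otimes> y)) ` ?R"
    then obtain s t where st: "s \<in> T k" "t \<in> T k" "s = g \<otimes> t" "i = (k, inv s \<otimes> y)"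
      by (auto simp: l_coset_def)
    have [simp]: "t \<in> carrier G" using st T(3) by auto
    have eq: "inv s \<otimes> y = inv t \<otimes> x"
      using st xy by (simp add: g_def inv_mult_group m_assoc)
    have "i \<in> ?A" unfolding st(4) eq nbhd_def using st(2) by (rule imageI)
    moreover have "i \<in> ?B" unfolding st(4) nbhd_def using st(1) by (rule imageI)
    ultimately show "i \<in> ?A \<inter> ?B" ..
  qed
  have R: "card ?R \<le> card (?A \<inter> ?B)"
  proof -
    have "card ?R = card ((\<lambda>t. (k, inv t \<otimes> y)) ` ?R)"
      using inj[OF xy(2)] by (intro card_image[symmetric]) (auto elim: inj_on_subset)
    also have "\<dots> \<le> card (?A \<inter> ?B)"
      using nbhd(1)[OF xy(1)] by (intro card_mono sub) auto
    finally show ?thesis .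
  qed
  have Tpos: "0 < card (T k)" using T by (simp add: card_gt_0_iff)
  have "P.prob {\<omega> \<in> space P. cell_label \<omega> k x \<noteq> cell_label \<omega> k y}
      \<le> real (card (?A - ?B) + card (?B - ?A)) / real (card (?A \<union> ?B))"
    unfolding cell_label_def using nbhd xy by (intro prob_Min_labels_neq) auto
  also have "\<dots> \<le> real (card (?A - ?B) + card (?B - ?A)) / real (card (T k))"
  proof (intro divide_left_mono)
    show "real (card (T k)) \<le> real (card (?A \<union> ?B))"
      using card_mono[of "?A \<union> ?B" ?A] nbhd xy card[OF xy(1)] by simp
    then show "0 < real (card (?A \<union> ?B)) * real (card (T k))" using Tpos by simp
  qed simp
  also have "card (?A - ?B) = card (T k) - card (?A \<inter> ?B)"
    using nbhd xy card by (subst card_Diff_subset_Int) auto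
  also have "card (?B - ?A) = card (T k) - card (?A \<inter> ?B)"
    using nbhd xy card by (subst card_Diff_subset_Int) (auto simp: Int_commute)
  also have "real (card (T k) - card (?A \<inter> ?B) + (card (T k) - card (?A \<inter> ?B))) / real (card (T k))
      \<le> real (2 * (card (T k) - card ?R)) / real (card (T k))"
    using R by (intro divide_right_mono) auto
  also have "\<dots> = 2 * (1 - real (card ?R) / real (card (T k)))"
  proof -
    have "card ?R \<le> card (T k)" using T by (intro card_mono) auto
    then show ?thesis using Tpos by (simp add: of_nat_diff field_simps)
  qed
  finally show ?thesis by (simp add: g_def)
qed

text \<open>Borel--Cantelli applies to each of the countably many pairs, with the summable defects
  as bounds; injectivity holds almost surely on the countable index set.\<close>

lemma AE_generic: "AE \<omega> in P. generic \<omega>"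
proof -
  have "AE \<omega> in P. \<forall>\<^sub>F k in sequentially. cell_label \<omega> k x = cell_label \<omega> k y"
    if xy: "x \<in> carrier G" "y \<in> carrier G" for x y
  proof -
    let ?D = "\<lambda>k. {\<omega> \<in> space P. cell_label \<omega> k x \<noteq> cell_label \<omega> k y}"
    have "AE \<omega> in P. \<forall>\<^sub>F k in sequentially. \<omega> \<in> space P - ?D k"
    proof (rule borel_cantelli_AE1)
      show "?D k \<in> sets P" for k
        using xy by (intro borel_measurable_neq measurable_cell_label)
      show "summable (\<lambda>k. P.prob (?D k))"
      proof (rule summable_comparison_test')
        show "summable (\<lambda>k. 2 * (1 - real (card (T k \<inter> ((y \<otimes> inv x) <#\<^bsub>G\<^esub> T k))) / real (card (T k))))"
          using T_summable xy by (intro summable_mult) auto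
        show "norm (P.prob (?D k)) \<le> 2 * (1 - real (card (T k \<inter> ((y \<otimes> inv x) <#\<^bsub>G\<^esub> T k))) / real (card (T k)))"
          if "0 \<le> k" for k
          using prob_cell_label_neq[OF xy, of k] by simp
      qed
    qed (simp add: P.emeasure_eq_measure)
    then show ?thesis
      by eventually_elim (auto elim: eventually_mono)
  qed
  then have "AE \<omega> in P. \<forall>x\<in>carrier G. \<forall>y\<in>carrier G. \<forall>\<^sub>F k in sequentially. cell_label \<omega> k x = cell_label \<omega> k y"
    by (intro AE_ball_countable' countable_carrier)
  with AE_labels_inj_on[OF countable_I subset_refl] show ?thesis
    by eventually_elim (simp add: generic_def)
qed

section \<open>Absence of extremal elements\<close>

text \<open>By shift invariance each element is least with the same probability, and these
  infinitely many events are disjoint. A general equivariant \<open>R\<close> is allowed so that the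
  converse relation handles greatest elements.\<close>

lemma AE_no_least:
  assumes pair: "\<And>x y. x \<in> carrier G \<Longrightarrow> y \<in> carrier G \<Longrightarrow> {\<omega> \<in> space P. (x, y) \<in> R \<omega>} \<in> sets P"
    and asym: "\<And>x y \<omega>. (x, y) \<in> R \<omega> \<Longrightarrow> (y, x) \<notin> R \<omega>"
    and equi: "\<And>g x y \<omega>. g \<in> carrier G \<Longrightarrow> x \<in> carrier G \<Longrightarrow> y \<in> carrier G \<Longrightarrow>
      (x, y) \<in> R (shift g \<omega>) \<longleftrightarrow> (x \<otimes> g, y \<otimes> g) \<in> R \<omega>"
  shows "AE \<omega> in P. \<forall>g\<in>carrier G. \<exists>a\<in>carrier G - {g}. (g, a) \<notin> R \<omega>"
proof -
  define N where "N g = {\<omega> \<in> space P. \<forall>a\<in>carrier G - {g}. (g, a) \<in> R \<omega>}" for g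
  have N_sets: "N g \<in> sets P" if "g \<in> carrier G" for g
    unfolding N_def using countable_carrier that
    by (intro sets.sets_Collect_countable_All' pair) auto
  have N_eq: "P.prob (N g) = P.prob (N \<one>)" if g: "g \<in> carrier G" for g
  proof -
    have "P.prob (N \<one>) = measure (distr P P (shift g)) (N \<one>)" by (simp add: distr_shift[OF g])
    also have "\<dots> = P.prob (shift g -` N \<one> \<inter> space P)"
      by (intro measure_distr measurable_shift g N_sets one_closed)
    also have "shift g -` N \<one> \<inter> space P = N g"
    proof -
      have "(\<forall>a\<in>carrier G - {\<one>}. (\<one>, a) \<in> R (shift g \<omega>)) \<longleftrightarrow> (\<forall>a\<in>carrier G - {g}. (g, a) \<in> R \<omega>)" for \<omega>
      proof -
        have eq: "(\<lambda>a. a \<otimes> g) ` (carrier G - {\<one>}) = carrier G - {g}"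
        proof (intro equalityI subsetI)
          fix b assume b: "b \<in> carrier G - {g}"
          then have "b = (b \<otimes> inv g) \<otimes> g" using g by (simp add: m_assoc)
          moreover have "b \<otimes> inv g \<noteq> \<one>" using b g calculation by auto
          ultimately show "b \<in> (\<lambda>a. a \<otimes> g) ` (carrier G - {\<one>})" using b g by blast
        qed (use g in auto)
        have "(\<forall>a\<in>(\<lambda>a. a \<otimes> g) ` (carrier G - {\<one>}). (g, a) \<in> R \<omega>)
            \<longleftrightarrow> (\<forall>a\<in>carrier G - {\<one>}. (g, a \<otimes> g) \<in> R \<omega>)"
          by blast
        then show ?thesis unfolding eq using equi[OF g one_closed] g by simp
      qed
      then show ?thesis
        unfolding N_def using measurable_space[OF measurable_shift[OF g]] by auto
    qed
    finally show ?thesis by simp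
  qed
  have disj: "disjoint_family_on N (carrier G)"
    unfolding disjoint_family_on_def
  proof (intro ballI impI equals0I)
    fix g h \<omega> assume "g \<in> carrier G" "h \<in> carrier G" "g \<noteq> h" "\<omega> \<in> N g \<inter> N h"
    then have "(g, h) \<in> R \<omega>" "(h, g) \<in> R \<omega>" by (auto simp: N_def)
    then show False using asym by blast
  qed
  have "P.prob (N \<one>) = 0"
    by (rule P.prob_eq_0_if_infinite_disjoint[OF infinite_carrier N_sets disj N_eq])
  then have "AE \<omega> in P. \<omega> \<notin> N g" if "g \<in> carrier G" for g
    using N_eq[OF that] N_sets[OF that]
    by (intro AE_not_in) (auto simp: null_sets_def P.emeasure_eq_measure)
  then have "AE \<omega> in P. \<forall>g\<in>carrier G. \<omega> \<notin> N g"
    by (intro AE_ball_countable' countable_carrier)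
  with AE_space show ?thesis
    by eventually_elim (auto simp: N_def)
qed

lemma AE_label_order_Z_orders: "AE \<omega> in P. label_order \<omega> \<in> Z_orders G"
proof -
  have asym: "(x, y) \<in> label_order \<omega> \<Longrightarrow> (y, x) \<notin> label_order \<omega>" for x y \<omega>
    using label_order_trans label_order_irrefl by blast
  have equi: "(x, y) \<in> label_order (shift g \<omega>) \<longleftrightarrow> (x \<otimes> g, y \<otimes> g) \<in> label_order \<omega>"
    if "g \<in> carrier G" "x \<in> carrier G" "y \<in> carrier G" for g x y \<omega>
    using that by (simp add: label_order_shift order_action_def)
  have "AE \<omega> in P. \<forall>g\<in>carrier G. \<exists>a\<in>carrier G - {g}. (g, a) \<notin> label_order \<omega>"
    by (rule AE_no_least) (auto simp: sets_pair_in_label_order asym equi)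
  moreover have "AE \<omega> in P. \<forall>g\<in>carrier G. \<exists>a\<in>carrier G - {g}. (g, a) \<notin> (label_order \<omega>)\<inverse>"
    by (rule AE_no_least) (auto simp: sets_pair_in_label_order asym equi)
  ultimately show ?thesis using AE_generic
  proof eventually_elim
    case (elim \<omega>)
    note total = label_order_total[OF elim(3)]
    have "strict_linear_order_on (carrier G) (label_order \<omega>)"
      unfolding strict_linear_order_on_def
    proof (intro conjI)
      show "trans (label_order \<omega>)" by (rule transI) (rule label_order_trans)
      show "irrefl (label_order \<omega>)" by (simp add: irrefl_def label_order_irrefl)
      show "total_on (carrier G) (label_order \<omega>)" using total by (simp add: total_on_def)
    qed
    moreover have "\<exists>a\<in>carrier G. (a, g) \<in> label_order \<omega>" if g: "g \<in> carrier G" for g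
    proof -
      obtain a where "a \<in> carrier G - {g}" "(g, a) \<notin> label_order \<omega>" using elim(1) g by blast
      then show ?thesis using total[of g a] g by blast
    qed
    moreover have "\<exists>b\<in>carrier G. (g, b) \<in> label_order \<omega>" if g: "g \<in> carrier G" for g
    proof -
      obtain b where "b \<in> carrier G - {g}" "(b, g) \<notin> label_order \<omega>" using elim(2) g by blast
      then show ?thesis using total[of g b] g by blast
    qed
    moreover have "label_order \<omega> \<subseteq> carrier G \<times> carrier G"
      by (auto simp: label_order_def)
    ultimately show ?case
      using finite_label_order_interval[OF elim(3)] by (simp add: Z_orders_def)
  qed
qed

text \<open>The multiorder is the law of \<open>label_order\<close> under \<open>P\<close>; its
  invariance comes from \<open>distr_shift\<close> and the equivariance
  \<open>label_order_shift\<close>.\<close>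

lemma ex_multiorder: "\<exists>\<nu>. multiorder G \<nu>"
proof -
  let ?Z = "Z_order_space G"
  obtain N where N: "{\<omega> \<in> space P. label_order \<omega> \<notin> Z_orders G} \<subseteq> N" "emeasure P N = 0" "N \<in> sets P"
    using AE_E[OF AE_label_order_Z_orders] by blast
  have N_notin: "AE \<omega> in P. \<omega> \<notin> N" using N by (intro AE_not_in) (auto simp: null_sets_def)
  have "space P - N \<noteq> {}"
  proof
    assume "space P - N = {}"
    then have "space P = N" using sets.sets_into_space[OF N(3)] by blast
    then show False using N(2) P.emeasure_space_1 by simp
  qed
  \<comment> \<open>A default for the null set \<open>N\<close>, so that \<open>\<Psi>\<close> takes
    values in \<open>Z_orders G\<close> everywhere; it is the order of some labelling outside
    \<open>N\<close>.\<close>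
  then obtain r0 where r0: "r0 \<in> Z_orders G" using N(1) by blast
  define \<Psi> where "\<Psi> \<omega> = (if \<omega> \<in> N then r0 else label_order \<omega>)" for \<omega>
  have \<Psi>: "\<Psi> \<in> measurable P ?Z"
  proof (rule measurable_Z_order_space)
    show "\<Psi> \<in> space P \<rightarrow> Z_orders G" using N(1) r0 by (auto simp: \<Psi>_def)
    fix a b
    have "{\<omega> \<in> space P. (a, b) \<in> \<Psi> \<omega>}
        = ({\<omega> \<in> space P. (a, b) \<in> label_order \<omega>} - N) \<union> (if (a, b) \<in> r0 then N else {})"
      using sets.sets_into_space[OF N(3)] by (auto simp: \<Psi>_def)
    then show "{\<omega> \<in> space P. (a, b) \<in> \<Psi> \<omega>} \<in> sets P"
      using sets_pair_in_label_order N(3) by auto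
  qed
  define \<nu> where "\<nu> = distr P ?Z \<Psi>"
  have "distr \<nu> \<nu> (order_action G g) = \<nu>" if g: "g \<in> carrier G" for g
  proof -
    \<comment> \<open>Because of the default, \<open>\<Psi>\<close> is known to commute with the
      action only where both \<open>\<omega>\<close> and \<open>shift g \<omega>\<close> avoid
      \<open>N\<close>. This is almost everywhere, since the shift preserves
      \<open>P\<close>.\<close>
    have "AE \<omega> in distr P P (shift g). \<omega> \<notin> N" unfolding distr_shift[OF g] by (rule N_notin)
    then have shift_notin: "AE \<omega> in P. shift g \<omega> \<notin> N"
      by (rule AE_distrD[OF measurable_shift[OF g]])
    have "distr \<nu> \<nu> (order_action G g) = distr \<nu> ?Z (order_action G g)"
      by (rule distr_cong) (simp_all add: \<nu>_def)
    also have "\<dots> = distr P ?Z (order_action G g \<circ> \<Psi>)"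
      unfolding \<nu>_def by (rule distr_distr[OF measurable_order_action[OF g] \<Psi>])
    also have "\<dots> = distr P ?Z (\<Psi> \<circ> shift g)"
    proof (rule distr_cong_AE)
      show "AE \<omega> in P. (order_action G g \<circ> \<Psi>) \<omega> = (\<Psi> \<circ> shift g) \<omega>"
        using N_notin shift_notin
        by eventually_elim (simp add: \<Psi>_def label_order_shift[OF g])
      show "order_action G g \<circ> \<Psi> \<in> measurable P ?Z"
        by (rule measurable_comp[OF \<Psi> measurable_order_action[OF g]])
      show "\<Psi> \<circ> shift g \<in> measurable P ?Z"
        by (rule measurable_comp[OF measurable_shift[OF g] \<Psi>])
    qed simp_all
    also have "\<dots> = distr (distr P P (shift g)) ?Z \<Psi>"
      by (rule distr_distr[OF \<Psi> measurable_shift[OF g], symmetric])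
    also have "\<dots> = \<nu>" unfolding distr_shift[OF g] \<nu>_def ..
    finally show ?thesis .
  qed
  moreover have "sets \<nu> = sets ?Z" by (simp add: \<nu>_def)
  moreover have "order_action G g \<in> measurable \<nu> \<nu>" if "g \<in> carrier G" for g
    using measurable_order_action[OF that] by (simp add: \<nu>_def)
  moreover have "prob_space \<nu>"
    unfolding \<nu>_def by (rule P.prob_space_distr[OF \<Psi>])
  ultimately have "multiorder G \<nu>" by (simp add: multiorder_def)
  then show ?thesis ..
qed

end

theorem corollary2p7:
  fixes G :: "('a, 'b) monoid_scheme"
  assumes "group G" and "infinite (carrier G)" and "countable (carrier G)"
  shows "amenable G \<longleftrightarrow> (\<exists>\<nu>. multiorder G \<nu>)"
proof -
  interpret group G by (rule assms(1))
  interpret countable_group G by unfold_locales (rule assms(3))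
  show ?thesis
  proof
    assume "amenable G"
    from amenable_summable_Folner[OF this] obtain T where "T 0 = {\<one>\<^bsub>G\<^esub>}"
      "\<forall>k. finite (T k) \<and> T k \<noteq> {} \<and> T k \<subseteq> carrier G"
      "\<forall>g\<in>carrier G.
        summable (\<lambda>k. 1 - real (card (T k \<inter> (g <#\<^bsub>G\<^esub> T k))) / real (card (T k)))"
      by (elim exE conjE)
    then interpret Folner_hierarchy G T
      using assms(2) by unfold_locales simp_all
    show "\<exists>\<nu>. multiorder G \<nu>" by (rule ex_multiorder)
  next
    assume "\<exists>\<nu>. multiorder G \<nu>"
    then obtain \<nu> where "multiorder G \<nu>" ..
    then show "amenable G" by (rule amenableI[OF multiorder_ex_Folner_set])
  qed
qed

end
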